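(* Let $\alpha\in(0,1)$, $\sigma=1-\alpha/2$, $T>0$; let $\lambda\in\mathcal{C}^2[0,T]$ with $\lambda(t)>0$, $\lambda'(t)\le0$ on $[0,T]$; let $k=k(t)$, $q=q(t)$ be functions on $[0,T]$ with $0<c_1\le k(t)\le c_2$ and $q(t)\ge0$; let $f$ be continuous on $[0,1]\times[0,T]$. Suppose $u\in\mathcal{C}^{6,3}_{x,t}$ on $[0,1]\times[0,T]$ is the solution of $$\partial_{0t}^{\alpha,\lambda(t)}u=k(t)\frac{\partial^2u}{\partial x^2}-q(t)u+f(x,t),\quad 0<x<1,\ 0<t\le T,$$ $$u(0,t)=u(1,t)=0\ (0\le t\le T),\qquad u(x,0)=u_0(x)\ (0\le x\le1).$$ Let $h=1/N$, $\tau=T/M$, $x_i=ih$, $t_j=j\tau$, and let $\{y_i^j\mid 0\le i\le N,\ 1\le j\le M\}$ be the solution of the compact difference scheme $$\Delta_{0t_{j+\sigma}}^{\alpha,\lambda(t)}\mathcal{H}_hy_i=a^{j+\sigma}y_{\bar xx,i}^{(\sigma)}-d^{j+\sigma}\mathcal{H}_hy_i^{(\sigma)}+\mathcal{H}_h\varphi_i^{j+\sigma},\quad i=1,\dots,N-1,\ j=0,\dots,M-1,$$ $$y_0^j=y_N^j=0\ (0\le j\le M),\qquad y_i^0=u_0(x_i)\ (0\le i\le N),$$ with notation defined in the context. Then $$\|u(\cdot,t_j)-y^j\|_0\le C_R\left(\tau^2+h^4\right),\qquad 1\le j\le M,$$ where $C_R$ is a positive constant not depending on $\tau$ and $h$.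
   Context: The generalized Caputo derivative is $\partial_{0t}^{\alpha,\lambda(t)}u(x,t)=\frac{1}{\Gamma(1-\alpha)}\int_0^t\frac{\lambda(t-\eta)}{(t-\eta)^\alpha}\frac{\partial u}{\partial\eta}(x,\eta)\,d\eta$. The class $\mathcal{C}^{6,3}_{x,t}$ consists of functions with continuous derivatives $\partial_x^r\partial_t^s u$ on the closed rectangle for $0\le r\le6$, $0\le s\le3$. Notation: $y_i^j=y(x_i,t_j)$, $t_{j+\sigma}=(j+\sigma)\tau$, $y^{(\sigma)}=\sigma y^{j+1}+(1-\sigma)y^j$, $v_{\bar xx,i}=(v_{i+1}-2v_i+v_{i-1})/h^2$, $\mathcal{H}_hv_i=v_i+\frac{h^2}{12}v_{\bar xx,i}$ for $i=1,\dots,N-1$, $a^{j+\sigma}=k(t_{j+\sigma})$, $d^{j+\sigma}=q(t_{j+\sigma})$, $\varphi_i^{j+\sigma}=f(x_i,t_{j+\sigma})$ ($0\le i\le N$), $\|v\|_0^2=\sum_{i=1}^{N-1}v_i^2h$. The discrete fractional derivative is $$\Delta_{0t_{j+\sigma}}^{\alpha,\lambda(t)}y_i=\frac{\tau^{1-\alpha}}{\Gamma(2-\alpha)}\sum_{s=0}^{j}c_{j-s}^{(\alpha)}\,\frac{y_i^{s+1}-y_i^s}{\tau}.$$ Its coefficients are as follows. Write $\lambda_s=\lambda(s\tau)$ for real $s$, $$a_0^{(\alpha)}=\sigma^{1-\alpha},\qquad a_l^{(\alpha)}=(l+\sigma)^{1-\alpha}-(l-1+\sigma)^{1-\alpha}\quad(l\ge1),$$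 $$b_l^{(\alpha)}=\tfrac{1}{2-\alpha}\left[(l+\sigma)^{2-\alpha}-(l-1+\sigma)^{2-\alpha}\right]-\tfrac12\left[(l+\sigma)^{1-\alpha}+(l-1+\sigma)^{1-\alpha}\right]\quad(l\ge1).$$ For $j=0$: $c_0^{(\alpha)}=\lambda_{\sigma-1/2}a_0^{(\alpha)}$. For $j\ge1$: $$c_s^{(\alpha)}=\begin{cases}\lambda_{\sigma-1/2}a_0^{(\alpha)}+\lambda_\sigma b_1^{(\alpha)}, & s=0,\\ \lambda_{s+\sigma-1/2}a_s^{(\alpha)}+\lambda_{s+\sigma}b_{s+1}^{(\alpha)}-\lambda_{s+\sigma}b_s^{(\alpha)}, & 1\le s\le j-1,\\ \lambda_{j+\sigma-1/2}a_j^{(\alpha)}-\lambda_{j+\sigma}b_j^{(\alpha)}, & s=j.\end{cases}$$ *)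

theory Defs
  imports "HOL-Analysis.Analysis"
begin

text \<open>Derivative relative to a set: on a nondegenerate closed interval this is the ordinary
  derivative in the interior and the one-sided derivative at the end points. Values of the
  function outside the interval play no role.\<close>

definition deriv_on :: "real set \<Rightarrow> (real \<Rightarrow> real) \<Rightarrow> real \<Rightarrow> real" where
  "deriv_on S g x = vector_derivative g (at x within S)"

definition C_class :: "nat \<Rightarrow> real set \<Rightarrow> (real \<Rightarrow> real) \<Rightarrow> bool" where
  "C_class n S g \<longleftrightarrow>
     (\<forall>m<n. (deriv_on S ^^ m) g differentiable_on S) \<and>
     (\<forall>m\<le>n. continuous_on S ((deriv_on S ^^ m) g))"

text \<open>The mixed derivative \<open>\<partial>\<^sub>x\<^sup>r \<partial>\<^sub>t\<^sup>s u\<close> (first \<open>s\<close> times in \<open>t\<close>, then \<open>r\<close> times in \<open>x\<close>)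
  on the rectangle \<open>[0,1] \<times> [0,T]\<close>.\<close>

definition partial_xt ::
    "real \<Rightarrow> nat \<Rightarrow> nat \<Rightarrow> (real \<Rightarrow> real \<Rightarrow> real) \<Rightarrow> real \<Rightarrow> real \<Rightarrow> real" where
  "partial_xt T r s u x t = (deriv_on {0..1} ^^ r) (\<lambda>\<xi>. (deriv_on {0..T} ^^ s) (u \<xi>) t) x"

text \<open>The class \<open>\<C>\<close> with indices \<open>p\<close> (in \<open>x\<close>) and \<open>q\<close> (in \<open>t\<close>). As \<open>deriv_on\<close> is a total
  function, existence of each derivative that is taken has to be demanded separately.\<close>

definition C_xt_class :: "real \<Rightarrow> nat \<Rightarrow> nat \<Rightarrow> (real \<Rightarrow> real \<Rightarrow> real) \<Rightarrow> bool" where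
  "C_xt_class T p q u \<longleftrightarrow>
     (\<forall>s<q. \<forall>x\<in>{0..1}. (\<lambda>t. partial_xt T 0 s u x t) differentiable_on {0..T}) \<and>
     (\<forall>r<p. \<forall>s\<le>q. \<forall>t\<in>{0..T}. (\<lambda>x. partial_xt T r s u x t) differentiable_on {0..1}) \<and>
     (\<forall>r\<le>p. \<forall>s\<le>q. continuous_on ({0..1} \<times> {0..T}) (\<lambda>(x, t). partial_xt T r s u x t))"

definition gen_caputo ::
    "real \<Rightarrow> (real \<Rightarrow> real) \<Rightarrow> real \<Rightarrow> (real \<Rightarrow> real \<Rightarrow> real) \<Rightarrow> real \<Rightarrow> real \<Rightarrow> real" where
  "gen_caputo \<alpha> lam T u x t =
     1 / Gamma (1 - \<alpha>) *
     integral {0..t} (\<lambda>\<eta>. lam (t - \<eta>) / (t - \<eta>) powr \<alpha> * partial_xt T 0 1 u x \<eta>)"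

definition is_exact_solution ::
    "real \<Rightarrow> (real \<Rightarrow> real) \<Rightarrow> real \<Rightarrow> (real \<Rightarrow> real) \<Rightarrow> (real \<Rightarrow> real) \<Rightarrow>
     (real \<Rightarrow> real \<Rightarrow> real) \<Rightarrow> (real \<Rightarrow> real) \<Rightarrow> (real \<Rightarrow> real \<Rightarrow> real) \<Rightarrow> bool" where
  "is_exact_solution \<alpha> lam T k q f u0 u \<longleftrightarrow>
     (\<forall>x t. 0 < x \<and> x < 1 \<and> 0 < t \<and> t \<le> T \<longrightarrow>
        gen_caputo \<alpha> lam T u x t = k t * partial_xt T 2 0 u x t - q t * u x t + f x t) \<and>
     (\<forall>t\<in>{0..T}. u 0 t = 0 \<and> u 1 t = 0) \<and>
     (\<forall>x\<in>{0..1}. u x 0 = u0 x)"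

definition a_coef :: "real \<Rightarrow> real \<Rightarrow> nat \<Rightarrow> real" where
  "a_coef \<alpha> \<sigma> l =
     (if l = 0 then \<sigma> powr (1 - \<alpha>)
      else (real l + \<sigma>) powr (1 - \<alpha>) - (real l - 1 + \<sigma>) powr (1 - \<alpha>))"

text \<open>Only used for \<open>l \<ge> 1\<close>.\<close>

definition b_coef :: "real \<Rightarrow> real \<Rightarrow> nat \<Rightarrow> real" where
  "b_coef \<alpha> \<sigma> l =
     1 / (2 - \<alpha>) * ((real l + \<sigma>) powr (2 - \<alpha>) - (real l - 1 + \<sigma>) powr (2 - \<alpha>))
     - 1 / 2 * ((real l + \<sigma>) powr (1 - \<alpha>) + (real l - 1 + \<sigma>) powr (1 - \<alpha>))"

text \<open>The coefficient with index \<open>s\<close> at time level \<open>j\<close>; meaningful for \<open>s \<le> j\<close>.\<close>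

definition c_coef ::
    "real \<Rightarrow> real \<Rightarrow> (real \<Rightarrow> real) \<Rightarrow> real \<Rightarrow> nat \<Rightarrow> nat \<Rightarrow> real" where
  "c_coef \<alpha> \<sigma> lam \<tau> j s =
     (let \<Lambda> = (\<lambda>r. lam (r * \<tau>)) in
      if j = 0 then \<Lambda> (\<sigma> - 1/2) * a_coef \<alpha> \<sigma> 0
      else if s = 0 then \<Lambda> (\<sigma> - 1/2) * a_coef \<alpha> \<sigma> 0 + \<Lambda> \<sigma> * b_coef \<alpha> \<sigma> 1
      else if s < j then
        \<Lambda> (real s + \<sigma> - 1/2) * a_coef \<alpha> \<sigma> s
        + \<Lambda> (real s + \<sigma>) * b_coef \<alpha> \<sigma> (s + 1) - \<Lambda> (real s + \<sigma>) * b_coef \<alpha> \<sigma> s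
      else \<Lambda> (real j + \<sigma> - 1/2) * a_coef \<alpha> \<sigma> j - \<Lambda> (real j + \<sigma>) * b_coef \<alpha> \<sigma> j)"

definition discr_caputo ::
    "real \<Rightarrow> real \<Rightarrow> (real \<Rightarrow> real) \<Rightarrow> real \<Rightarrow> nat \<Rightarrow> (nat \<Rightarrow> real) \<Rightarrow> real" where
  "discr_caputo \<alpha> \<sigma> lam \<tau> j v =
     \<tau> powr (1 - \<alpha>) / Gamma (2 - \<alpha>) *
     (\<Sum>s = 0..j. c_coef \<alpha> \<sigma> lam \<tau> j (j - s) * ((v (s + 1) - v s) / \<tau>))"

text \<open>A grid function is a map \<open>y\<close> with \<open>y i j\<close> the value at the node \<open>(i h, j \<tau>)\<close>. The two
  spatial operators are only used at interior indices, so \<open>i - 1\<close> is not truncated.\<close>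

definition second_diff :: "real \<Rightarrow> (nat \<Rightarrow> real) \<Rightarrow> nat \<Rightarrow> real" where
  "second_diff h v i = (v (i + 1) - 2 * v i + v (i - 1)) / h\<^sup>2"

definition compact_avg :: "real \<Rightarrow> (nat \<Rightarrow> real) \<Rightarrow> nat \<Rightarrow> real" where
  "compact_avg h v i = v i + h\<^sup>2 / 12 * second_diff h v i"

definition sigma_avg :: "real \<Rightarrow> (nat \<Rightarrow> nat \<Rightarrow> real) \<Rightarrow> nat \<Rightarrow> nat \<Rightarrow> real" where
  "sigma_avg \<sigma> y j i = \<sigma> * y i (j + 1) + (1 - \<sigma>) * y i j"

definition is_scheme_solution ::
    "real \<Rightarrow> real \<Rightarrow> (real \<Rightarrow> real) \<Rightarrow> real \<Rightarrow> (real \<Rightarrow> real) \<Rightarrow> (real \<Rightarrow> real) \<Rightarrow>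
     (real \<Rightarrow> real \<Rightarrow> real) \<Rightarrow> (real \<Rightarrow> real) \<Rightarrow> nat \<Rightarrow> nat \<Rightarrow> (nat \<Rightarrow> nat \<Rightarrow> real) \<Rightarrow> bool" where
  "is_scheme_solution \<alpha> \<sigma> lam T k q f u0 N M y \<longleftrightarrow>
     (let h = 1 / real N; \<tau> = T / real M in
       (\<forall>i\<in>{1..N-1}. \<forall>j<M.
          let t\<^sub>\<sigma> = (real j + \<sigma>) * \<tau> in
          discr_caputo \<alpha> \<sigma> lam \<tau> j (\<lambda>s. compact_avg h (\<lambda>m. y m s) i)
          = k t\<^sub>\<sigma> * second_diff h (sigma_avg \<sigma> y j) i
            - q t\<^sub>\<sigma> * compact_avg h (sigma_avg \<sigma> y j) i
            + compact_avg h (\<lambda>m. f (real m * h) t\<^sub>\<sigma>) i) \<and>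
       (\<forall>j\<le>M. y 0 j = 0 \<and> y N j = 0) \<and>
       (\<forall>i\<le>N. y i 0 = u0 (real i * h)))"

definition l2_norm :: "nat \<Rightarrow> (nat \<Rightarrow> real) \<Rightarrow> real" where
  "l2_norm N v = sqrt (\<Sum>i\<in>{1..N-1}. (v i)\<^sup>2 * (1 / real N))"

end

theory Submission
  imports Defs
begin

text \<open>The error \<open>z = u - y\<close> satisfies the scheme with a right-hand side \<open>\<psi> + q r\<close>, where
  \<open>\<psi> = O(\<tau>\<^sup>2 + h\<^sup>4)\<close> and \<open>r = O(\<tau>\<^sup>2)\<close> uniformly in the data. As \<open>q\<close> need not be bounded, \<open>q r\<close> cannot be
  treated as a source term. Instead, put \<open>V = H z\<close> for the compact averaging \<open>H\<close> and
  \<open>w = \<sigma> V\<^sup>j\<^sup>+\<^sup>1 + (1 - \<sigma>) V\<^sup>j\<close>. If \<open>\<parallel>w\<parallel>\<close> exceeds a bound \<open>\<rho> = O(\<tau>\<^sup>2 + h\<^sup>4)\<close>, then the damping terms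
  dominate and \<open>\<langle>w, \<Delta> V\<rangle> \<le> 0\<close>; since the coefficients \<open>c\<close> are nonnegative and decreasing with
  \<open>(2 \<sigma> - 1) c\<^sub>0 \<ge> \<sigma> c\<^sub>1\<close>, the norm of \<open>V\<^sup>j\<^sup>+\<^sup>1\<close> is then at most the maximum over the earlier levels.
  Otherwise \<open>\<parallel>V\<^sup>j\<^sup>+\<^sup>1\<parallel> \<le> (\<rho> + (1 - \<sigma>) \<parallel>V\<^sup>j\<parallel>) / \<sigma>\<close>. Either way the bound \<open>\<rho> / (2 \<sigma> - 1)\<close> propagates
  from level to level. The choice \<open>\<sigma> = 1 - \<alpha>/2\<close> enters once more in the truncation error, as it makes
  the first moment of the kernel over the last, partial time step vanish.\<close>

section \<open>Coefficients of the discrete fractional derivative\<close>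

text \<open>The discrete derivative integrates an interpolant exactly against the singular kernel.
  On a full time cell the factor \<open>lam (t - s) * v' s\<close> is replaced by an affine
  function: its midpoint value uses the difference quotient of the cell, its slope uses two
  consecutive quotients. Up to common factors, \<open>a\<close> and \<open>b\<close> are the zeroth
  moment of the kernel over the cell and its first moment about the midpoint; collecting terms by
  quotient instead of by cell gives \<open>c\<close>. The last cell is cut off at \<open>t\<close>
  and has no successor, so no slope is available there. The error on a cell is O(\<tau>^2) times the
  kernel mass of the cell. The masses add up to a bounded quantity although the number of cells
  grows, which yields a rate uniform in the time level. The error is tested with the average of
  \<open>H z\<close>, not of \<open>z\<close>, because the discrete time derivative acts on
  \<open>H z\<close>. The space term then becomes a product of \<open>H z\<close> with the second
  difference of \<open>z\<close>. It has a sign because \<open>H\<close> differs from the identity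
  by a twelfth of an operator whose square is controlled by the Dirichlet sum, with factor
  4.\<close>

lemma trapezoid_le_of_deriv2_antimono:
  fixes F f g :: "real \<Rightarrow> real"
  assumes F: "\<And>y. x \<le> y \<Longrightarrow> (F has_real_derivative f y) (at y)"
    and f: "\<And>y. x \<le> y \<Longrightarrow> (f has_real_derivative g y) (at y)"
    and g: "\<And>y z. x \<le> y \<Longrightarrow> y \<le> z \<Longrightarrow> g z \<le> g y"
  shows "(f x + f (x + 1)) / 2 \<le> F (x + 1) - F x"
proof -
  \<comment> \<open>\<open>h y\<close> is the trapezoidal error over [x, y]. Its derivative is half
    the gap between the increment of \<open>f\<close> and \<open>(y - x) * g y\<close>, nonnegative
    because \<open>f\<close> is concave.\<close>
  define h where "h = (\<lambda>y. F y - F x - (y - x) / 2 * (f x + f y))"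
  have "h x \<le> h (x + 1)"
  proof (rule DERIV_nonneg_imp_nondecreasing[of x "x + 1" h])
    fix y assume y: "x \<le> y" "y \<le> x + 1"
    have *: "(h has_real_derivative (f y - f x - (y - x) * g y) / 2) (at y)"
      unfolding h_def
      by (rule derivative_eq_intros F f y refl | simp)+ (simp add: field_simps)
    have "(y - x) * g y \<le> f y - f x"
    proof (cases "x = y")
      case False
      then have "x < y" using y by simp
      from MVT2[OF this, of f g] f obtain z where z: "x < z" "z < y" "f y - f x = (y - x) * g z"
        by auto
      with g[of z y] y show ?thesis by (auto intro: mult_left_mono)
    qed simp
    with * show "\<exists>d. (h has_real_derivative d) (at y) \<and> 0 \<le> d" by fastforce
  qed simp
  then show ?thesis by (simp add: h_def field_simps)
qed

lemma DERIV_powr_const: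
  fixes y r c :: real
  assumes "0 < y" "c = r - 1"
  shows "((\<lambda>y. y powr r) has_real_derivative r * y powr c) (at y)"
  using has_real_derivative_powr[OF assms(1), of r] assms(2) by simp

lemma DERIV_powr_shift:
  fixes y r c :: real
  assumes "0 < y + d" "c = r - 1"
  shows "((\<lambda>y. (y + d) powr r) has_real_derivative r * (y + d) powr c) (at y)"
  using DERIV_shift[of "\<lambda>y. y powr r" _ y d] DERIV_powr_const[OF assms] by simp

locale caputo_exponent =
  fixes \<alpha> \<sigma> :: real
  assumes \<alpha>: "0 < \<alpha>" "\<alpha> < 1" and \<sigma>: "\<sigma> = 1 - \<alpha> / 2"
begin

lemma \<sigma>_bounds: "1 / 2 < \<sigma>" "\<sigma> < 1" "2 * \<sigma> - 1 = 1 - \<alpha>" "0 < \<sigma>"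
  using \<alpha> \<sigma> by auto

abbreviation a where "a \<equiv> a_coef \<alpha> \<sigma>"
abbreviation b where "b \<equiv> b_coef \<alpha> \<sigma>"

definition x\<^sub>\<sigma> :: "nat \<Rightarrow> real" where "x\<^sub>\<sigma> l = real l - 1 + \<sigma>"

lemma x\<^sub>\<sigma>_pos: "1 \<le> l \<Longrightarrow> 0 < x\<^sub>\<sigma> l"
  using \<sigma>_bounds by (auto simp: x\<^sub>\<sigma>_def)

lemma x\<^sub>\<sigma>_Suc: "x\<^sub>\<sigma> (Suc l) = x\<^sub>\<sigma> l + 1"
  by (simp add: x\<^sub>\<sigma>_def)

text \<open>The error of the trapezoidal rule for \<open>s powr (1 - \<alpha>)\<close> on
  [x, x + 1]. A real argument turns monotonicity of \<open>b\<close> in its index into a question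
  about a derivative.\<close>

definition B :: "real \<Rightarrow> real" where
  "B x = ((x + 1) powr (2 - \<alpha>) - x powr (2 - \<alpha>)) / (2 - \<alpha>) - ((x + 1) powr (1 - \<alpha>) + x powr (1 - \<alpha>)) / 2"

lemma a_eq: "1 \<le> l \<Longrightarrow> a l = (x\<^sub>\<sigma> l + 1) powr (1 - \<alpha>) - x\<^sub>\<sigma> l powr (1 - \<alpha>)"
  by (simp add: a_coef_def x\<^sub>\<sigma>_def algebra_simps)

lemma b_eq: "1 \<le> l \<Longrightarrow> b l = B (x\<^sub>\<sigma> l)"
  by (simp add: b_coef_def B_def x\<^sub>\<sigma>_def add.commute)

lemma DERIV_B:
  assumes "0 < x"
  shows "(B has_real_derivative (x + 1) powr (1 - \<alpha>) - x powr (1 - \<alpha>)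
            - (1 - \<alpha>) / 2 * ((x + 1) powr (-\<alpha>) + x powr (-\<alpha>))) (at x)"
  unfolding B_def
proof -
  have "((\<lambda>x. ((x + 1) powr (2 - \<alpha>) - x powr (2 - \<alpha>)) / (2 - \<alpha>) - ((x + 1) powr (1 - \<alpha>) + x powr (1 - \<alpha>)) / 2)
    has_real_derivative ((2 - \<alpha>) * (x + 1) powr (1 - \<alpha>) - (2 - \<alpha>) * x powr (1 - \<alpha>)) / (2 - \<alpha>)
      - ((1 - \<alpha>) * (x + 1) powr (-\<alpha>) + (1 - \<alpha>) * x powr (-\<alpha>)) / 2) (at x)"
    by (intro DERIV_diff DERIV_add DERIV_cdivide DERIV_powr_const DERIV_powr_shift) (use assms in auto)
  then show "((\<lambda>x. ((x + 1) powr (2 - \<alpha>) - x powr (2 - \<alpha>)) / (2 - \<alpha>) - ((x + 1) powr (1 - \<alpha>) + x powr (1 - \<alpha>)) / 2)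
    has_real_derivative (x + 1) powr (1 - \<alpha>) - x powr (1 - \<alpha>)
            - (1 - \<alpha>) / 2 * ((x + 1) powr (-\<alpha>) + x powr (-\<alpha>))) (at x)"
    by (rule DERIV_cong) (use \<alpha> in \<open>simp add: divide_simps, simp add: algebra_simps\<close>)
qed

lemma powr_neg_antimono: "0 < x \<Longrightarrow> x \<le> y \<Longrightarrow> r \<le> 0 \<Longrightarrow> y powr r \<le> (x::real) powr r"
  by (rule powr_mono2') auto

text \<open>The trapezoidal rule underestimates the integral of a concave function.\<close>

lemma B_nonneg: assumes "0 < x" shows "0 \<le> B x"
proof -
  have "(x powr (1 - \<alpha>) + (x + 1) powr (1 - \<alpha>)) / 2
      \<le> (x + 1) powr (2 - \<alpha>) / (2 - \<alpha>) - x powr (2 - \<alpha>) / (2 - \<alpha>)"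
  proof (rule trapezoid_le_of_deriv2_antimono[where g = "\<lambda>y. (1 - \<alpha>) * y powr (-\<alpha>)"])
    fix y assume "x \<le> y"
    with assms have y: "0 < y" by simp
    show "((\<lambda>x. x powr (2 - \<alpha>) / (2 - \<alpha>)) has_real_derivative y powr (1 - \<alpha>)) (at y)"
      using DERIV_cdivide[OF DERIV_powr_const[OF y, of "1 - \<alpha>" "2 - \<alpha>"], of "2 - \<alpha>"] \<alpha> by simp
    show "((\<lambda>x. x powr (1 - \<alpha>)) has_real_derivative (1 - \<alpha>) * y powr (-\<alpha>)) (at y)"
      using DERIV_powr_const[OF y, of "-\<alpha>" "1 - \<alpha>"] by simp
  qed (use assms \<alpha> in \<open>auto intro!: mult_left_mono powr_neg_antimono\<close>)
  then show ?thesis by (simp add: B_def diff_divide_distrib add.commute)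
qed

text \<open>The derivative of \<open>B\<close> is again a trapezoidal error, now of the convex
  function \<open>(1 - \<alpha>) * s powr (-\<alpha>)\<close>, hence nonpositive. The trapezoid
  lemma is applied to the negative of this function.\<close>

lemma B_antimono: assumes "0 < x" "x \<le> y" shows "B y \<le> B x"
  using assms(2)
proof (rule DERIV_nonpos_imp_nonincreasing)
  fix z assume "x \<le> z" "z \<le> y"
  then have z: "0 < z" using assms by simp
  have "(- ((1 - \<alpha>) * z powr (-\<alpha>)) + - ((1 - \<alpha>) * (z + 1) powr (-\<alpha>))) / 2
      \<le> - ((z + 1) powr (1 - \<alpha>)) - - (z powr (1 - \<alpha>))"
  proof (rule trapezoid_le_of_deriv2_antimono[where g = "\<lambda>y. \<alpha> * (1 - \<alpha>) * y powr (-\<alpha> - 1)"])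
    fix y assume "z \<le> y"
    with z have y: "0 < y" by simp
    show "((\<lambda>x. - (x powr (1 - \<alpha>))) has_real_derivative - ((1 - \<alpha>) * y powr (-\<alpha>))) (at y)"
      by (rule DERIV_minus) (use DERIV_powr_const[OF y, of "-\<alpha>" "1 - \<alpha>"] in simp)
    show "((\<lambda>x. - ((1 - \<alpha>) * x powr (-\<alpha>))) has_real_derivative \<alpha> * (1 - \<alpha>) * y powr (-\<alpha> - 1)) (at y)"
      using DERIV_minus[OF DERIV_cmult[OF DERIV_powr_const[OF y, of "-\<alpha> - 1" "-\<alpha>"], of "1 - \<alpha>"]]
      by (simp add: algebra_simps)
  qed (use z \<alpha> in \<open>auto intro!: mult_left_mono powr_neg_antimono\<close>)
  then show "\<exists>d. (B has_real_derivative d) (at z) \<and> d \<le> 0"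
    using DERIV_B[OF z] by (intro exI conjI) (auto simp: field_simps)
qed

text \<open>The integral is at most the right end value; subtracting the mean of both end values
  leaves half the increment. This keeps \<open>b l\<close> below \<open>a l\<close>.\<close>

lemma B_le_half_diff: assumes "0 < x" shows "B x \<le> ((x + 1) powr (1 - \<alpha>) - x powr (1 - \<alpha>)) / 2"
proof -
  have *: "((\<lambda>x. x powr (2 - \<alpha>) / (2 - \<alpha>)) has_real_derivative y powr (1 - \<alpha>)) (at y)" if "x \<le> y" for y
    using DERIV_cdivide[OF DERIV_powr_const[of y "1 - \<alpha>" "2 - \<alpha>"], of "2 - \<alpha>"] \<alpha> assms that by simp
  from MVT2[of x "x + 1" "\<lambda>x. x powr (2 - \<alpha>) / (2 - \<alpha>)" "\<lambda>y. y powr (1 - \<alpha>)"] *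
  obtain z where z: "x < z" "z < x + 1"
      "(x + 1) powr (2 - \<alpha>) / (2 - \<alpha>) - x powr (2 - \<alpha>) / (2 - \<alpha>) = z powr (1 - \<alpha>)"
    by auto
  moreover have "z powr (1 - \<alpha>) \<le> (x + 1) powr (1 - \<alpha>)"
    using z assms \<alpha> by (intro powr_mono2) auto
  ultimately show ?thesis by (simp add: B_def diff_divide_distrib add_divide_distrib)
qed

lemma b_nonneg: "1 \<le> l \<Longrightarrow> 0 \<le> b l"
  by (simp add: b_eq B_nonneg x\<^sub>\<sigma>_pos)

lemma b_Suc_le: "1 \<le> l \<Longrightarrow> b (Suc l) \<le> b l"
  by (simp add: b_eq x\<^sub>\<sigma>_Suc B_antimono x\<^sub>\<sigma>_pos)

lemma a_nonneg: "0 \<le> a l"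
  using x\<^sub>\<sigma>_pos[of l] \<alpha> by (cases "l = 0") (auto simp: a_eq powr_mono2, simp add: a_coef_def)

lemma a_0_pos: "0 < a 0"
  using \<sigma>_bounds by (simp add: a_coef_def)

lemma b_le_a: "1 \<le> l \<Longrightarrow> b l \<le> a l"
  using B_le_half_diff[OF x\<^sub>\<sigma>_pos, of l] a_nonneg[of l] by (simp add: a_eq b_eq)

text \<open>Decrease of \<open>c\<close> will be reduced to
  \<open>a (s + 1) \<le> a s + b (s + 1) - b s\<close>, which is this inequality rearranged.\<close>

lemma a_diff_b_antimono:
  assumes "1 \<le> l"
  shows "a (Suc l) - b (Suc l) \<le> a l - b l"
proof -
  define G where "G x = (x + 1) powr (1 - \<alpha>) - x powr (1 - \<alpha>) - B x" for x
  have "G (x\<^sub>\<sigma> l + 1) \<le> G (x\<^sub>\<sigma> l)"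
  proof (rule DERIV_nonpos_imp_nonincreasing[of "x\<^sub>\<sigma> l" "x\<^sub>\<sigma> l + 1" G])
    fix y assume "x\<^sub>\<sigma> l \<le> y"
    then have y: "0 < y" using x\<^sub>\<sigma>_pos[OF assms] by simp
    define d where "d = (1 - \<alpha>) * (y + 1) powr (-\<alpha>) - (1 - \<alpha>) * y powr (-\<alpha>) - 
       ((y + 1) powr (1 - \<alpha>) - y powr (1 - \<alpha>) - (1 - \<alpha>) / 2 * ((y + 1) powr (-\<alpha>) + y powr (-\<alpha>)))"
    have "(G has_real_derivative d) (at y)"
      unfolding G_def d_def
      by (intro DERIV_diff DERIV_powr_const DERIV_powr_shift DERIV_B) (use y in auto)
    moreover have "d \<le> 0"
    proof -
      have "((\<lambda>x. x powr (1 - \<alpha>)) has_real_derivative (1 - \<alpha>) * z powr (-\<alpha>)) (at z)" if "y \<le> z" for z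
        using DERIV_powr_const[of z "-\<alpha>" "1 - \<alpha>"] that y by simp
      with MVT2[of y "y + 1" "\<lambda>x. x powr (1 - \<alpha>)" "\<lambda>z. (1 - \<alpha>) * z powr (-\<alpha>)"]
      obtain z where z: "y < z" "z < y + 1" "(y + 1) powr (1 - \<alpha>) - y powr (1 - \<alpha>) = (1 - \<alpha>) * z powr (-\<alpha>)"
        by auto
      \<comment> \<open>With p, m, q the values of
        \<open>(1 - \<alpha>) * s powr (-\<alpha>)\<close> at y, z, y + 1, the derivative is
        \<open>d = (3 * q - p) / 2 - m\<close>, and \<open>q \<le> m\<close>,
        \<open>q \<le> p\<close> make it nonpositive.\<close>
      have "(1 - \<alpha>) * (y + 1) powr (-\<alpha>) \<le> (1 - \<alpha>) * z powr (-\<alpha>)"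
           "(1 - \<alpha>) * z powr (-\<alpha>) \<le> (1 - \<alpha>) * y powr (-\<alpha>)"
        using z y \<alpha> by (auto intro!: mult_left_mono powr_neg_antimono)
      then show ?thesis unfolding d_def z(3) by (simp add: field_simps)
    qed
    ultimately show "\<exists>d. (G has_real_derivative d) (at y) \<and> d \<le> 0" by blast
  qed simp
  then show ?thesis using assms by (simp add: a_eq b_eq x\<^sub>\<sigma>_Suc G_def)
qed

text \<open>By the weighted arithmetic-geometric mean inequality
  \<open>\<sigma>\<^sup>\<alpha> (1 + \<sigma>)\<^bsup>1-\<alpha>\<^esup> \<le> \<alpha> \<sigma> + (1 - \<alpha>) (1 + \<sigma>) = 3 \<sigma> - 1\<close>.\<close>

lemma a_1_le: "\<sigma> * a 1 \<le> (1 - \<alpha>) * a 0"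
proof -
  have "\<sigma> powr \<alpha> * (1 + \<sigma>) powr (1 - \<alpha>) \<le> \<alpha> * \<sigma> + (1 - \<alpha>) * (1 + \<sigma>)"
    using Youngs_inequality_0[of \<alpha> "1 - \<alpha>" \<sigma> "1 + \<sigma>"] \<alpha> \<sigma>_bounds by simp
  also have "\<dots> = \<sigma> + (1 - \<alpha>)" by (simp add: algebra_simps)
  finally have "(\<sigma> powr \<alpha> * (1 + \<sigma>) powr (1 - \<alpha>)) * \<sigma> powr (1 - \<alpha>) \<le> (\<sigma> + (1 - \<alpha>)) * \<sigma> powr (1 - \<alpha>)"
    by (rule mult_right_mono) simp
  moreover have "\<sigma> powr \<alpha> * \<sigma> powr (1 - \<alpha>) = \<sigma>"
    using \<sigma>_bounds by (simp flip: powr_add)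
  ultimately have "\<sigma> * (1 + \<sigma>) powr (1 - \<alpha>) \<le> (\<sigma> + (1 - \<alpha>)) * \<sigma> powr (1 - \<alpha>)"
    by (metis mult.assoc mult.commute)
  then show ?thesis by (simp add: a_coef_def algebra_simps)
qed

lemma c_coef_eq:
  assumes "s \<le> j"
  shows "c_coef \<alpha> \<sigma> lam \<tau> j s = lam ((real s + \<sigma> - 1/2) * \<tau>) * a s
     + (if s < j then lam ((real s + \<sigma>) * \<tau>) * b (Suc s) else 0)
     - (if 1 \<le> s then lam ((real s + \<sigma>) * \<tau>) * b s else 0)"
  using assms by (auto simp: c_coef_def)

end

section \<open>Sign and monotonicity of the coefficients \<open>c\<close> for a nonincreasing memory
  function\<close>

locale memory_kernel = caputo_exponent +
  fixes T :: real and lam :: "real \<Rightarrow> real"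
  assumes lam_pos: "\<And>t. t \<in> {0..T} \<Longrightarrow> 0 < lam t"
    and lam_antimono: "\<And>s t. 0 \<le> s \<Longrightarrow> s \<le> t \<Longrightarrow> t \<le> T \<Longrightarrow> lam t \<le> lam s"
begin

context
  fixes \<tau> :: real and j :: nat
  assumes \<tau>: "0 < \<tau>" and jT: "(real j + \<sigma>) * \<tau> \<le> T"
begin

text \<open>Every argument of \<open>lam\<close> in \<open>c_coef\<close> has the form
  \<open>r * \<tau>\<close> with r in this range. The smallest one, \<open>\<sigma> - 1/2\<close>,
  is positive because \<open>\<sigma> > 1/2\<close>.\<close>

lemma node_in: assumes "0 \<le> r" "r \<le> real j + \<sigma>" shows "0 \<le> r * \<tau>" "r * \<tau> \<le> T"
  using order_trans[OF mult_right_mono[OF assms(2), of \<tau>] jT] assms \<tau> by auto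

lemma lam_node_pos: "0 \<le> r \<Longrightarrow> r \<le> real j + \<sigma> \<Longrightarrow> 0 < lam (r * \<tau>)"
  using node_in lam_pos by simp

lemma lam_node_antimono: "0 \<le> r \<Longrightarrow> r \<le> s \<Longrightarrow> s \<le> real j + \<sigma> \<Longrightarrow> lam (s * \<tau>) \<le> lam (r * \<tau>)"
  using node_in[of s] \<tau> by (intro lam_antimono) (auto intro: mult_right_mono)

lemma c_coef_0_ge: "lam (\<sigma> * \<tau>) * a 0 \<le> c_coef \<alpha> \<sigma> lam \<tau> j 0"
proof -
  have "lam (\<sigma> * \<tau>) * a 0 \<le> lam ((\<sigma> - 1/2) * \<tau>) * a 0"
    using \<sigma>_bounds a_0_pos by (intro mult_right_mono lam_node_antimono) auto
  moreover have "0 \<le> lam (\<sigma> * \<tau>) * b (Suc 0)"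
    using lam_node_pos[of \<sigma>] \<sigma>_bounds b_nonneg[of 1] by auto
  ultimately show ?thesis by (subst c_coef_eq) auto
qed

lemma c_coef_0_pos: "0 < c_coef \<alpha> \<sigma> lam \<tau> j 0"
proof -
  have "0 < lam (\<sigma> * \<tau>) * a 0"
    using \<sigma>_bounds a_0_pos lam_node_pos[of \<sigma>] by simp
  then show ?thesis using c_coef_0_ge by linarith
qed

text \<open>The half-step shift of \<open>lam\<close> in front of \<open>a\<close> makes
  neighbouring coefficients comparable: the node \<open>s + \<sigma>\<close> lies half a step after
  the one used with \<open>a s\<close> and half a step before the one used with
  \<open>a (s + 1)\<close>. So \<open>c\<close> at s is bounded below, and at s + 1 above, by
  expressions with the same factor \<open>lam ((s + \<sigma>) * \<tau>)\<close>.\<close>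

lemma c_coef_ge:
  assumes "1 \<le> s" "s \<le> j"
  shows "lam ((real s + \<sigma>) * \<tau>) * (a s + (if s < j then b (Suc s) else 0) - b s) \<le> c_coef \<alpha> \<sigma> lam \<tau> j s"
proof -
  have "lam ((real s + \<sigma>) * \<tau>) * a s \<le> lam ((real s + \<sigma> - 1/2) * \<tau>) * a s"
    using \<sigma>_bounds a_nonneg assms by (intro mult_right_mono lam_node_antimono) auto
  then show ?thesis using assms by (subst c_coef_eq) (auto simp: algebra_simps)
qed

lemma c_coef_Suc_le:
  assumes "s < j"
  shows "c_coef \<alpha> \<sigma> lam \<tau> j (Suc s) \<le> lam ((real s + \<sigma>) * \<tau>) * a (Suc s)"
proof -
  have "lam ((real (Suc s) + \<sigma> - 1/2) * \<tau>) * a (Suc s) \<le> lam ((real s + \<sigma>) * \<tau>) * a (Suc s)"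
    using \<sigma>_bounds a_nonneg assms by (intro mult_right_mono lam_node_antimono) auto
  moreover have "0 \<le> lam ((real (Suc s) + \<sigma>) * \<tau>)"
    using lam_node_pos[of "real (Suc s) + \<sigma>"] assms \<sigma>_bounds by simp
  then have "lam ((real (Suc s) + \<sigma>) * \<tau>) * b (Suc (Suc s)) \<le> lam ((real (Suc s) + \<sigma>) * \<tau>) * b (Suc s)"
    "0 \<le> lam ((real (Suc s) + \<sigma>) * \<tau>) * b (Suc s)"
    using b_Suc_le[of "Suc s"] b_nonneg[of "Suc s"] by (auto intro: mult_left_mono)
  ultimately show ?thesis using assms by (subst c_coef_eq) auto
qed

lemma c_coef_nonneg:
  assumes "s \<le> j"
  shows "0 \<le> c_coef \<alpha> \<sigma> lam \<tau> j s"
proof (cases "s = 0")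
  case False
  then have s: "1 \<le> s" by simp
  have "0 \<le> lam ((real s + \<sigma>) * \<tau>) * (a s + (if s < j then b (Suc s) else 0) - b s)"
    using lam_node_pos[of "real s + \<sigma>"] assms \<sigma>_bounds b_le_a[OF s] b_nonneg[of "Suc s"]
    by (intro mult_nonneg_nonneg) auto
  then show ?thesis using c_coef_ge[OF s assms] by linarith
qed (use c_coef_0_pos in auto)

text \<open>Since \<open>1 - \<alpha> = 2 * \<sigma> - 1\<close>, this is the condition on the two
  most recent weights in the energy inequality below.\<close>

lemma c_coef_1_le:
  assumes "1 \<le> j"
  shows "\<sigma> * c_coef \<alpha> \<sigma> lam \<tau> j 1 \<le> (1 - \<alpha>) * c_coef \<alpha> \<sigma> lam \<tau> j 0"
proof -
  have "\<sigma> * c_coef \<alpha> \<sigma> lam \<tau> j 1 \<le> \<sigma> * (lam (\<sigma> * \<tau>) * a 1)"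
    using c_coef_Suc_le[of 0] assms \<sigma>_bounds by (intro mult_left_mono) auto
  also have "\<dots> \<le> lam (\<sigma> * \<tau>) * ((1 - \<alpha>) * a 0)"
    using mult_left_mono[OF a_1_le, of "lam (\<sigma> * \<tau>)"] lam_node_pos[of \<sigma>] \<sigma>_bounds
    by (simp add: mult_ac)
  also have "\<dots> = (1 - \<alpha>) * (lam (\<sigma> * \<tau>) * a 0)" by simp
  also have "\<dots> \<le> (1 - \<alpha>) * c_coef \<alpha> \<sigma> lam \<tau> j 0"
    using c_coef_0_ge \<alpha> by (intro mult_left_mono) auto
  finally show ?thesis .
qed

lemma c_coef_antimono:
  assumes "s < j"
  shows "c_coef \<alpha> \<sigma> lam \<tau> j (Suc s) \<le> c_coef \<alpha> \<sigma> lam \<tau> j s"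
proof (cases "s = 0")
  case True
  \<comment> \<open>\<open>a_diff_b_antimono\<close> starts at index 1, so the first pair is settled
    by \<open>c_coef_1_le\<close> together with \<open>1 - \<alpha> \<le> \<sigma>\<close>.\<close>
  have "\<sigma> * c_coef \<alpha> \<sigma> lam \<tau> j 1 \<le> (1 - \<alpha>) * c_coef \<alpha> \<sigma> lam \<tau> j 0"
    using assms by (intro c_coef_1_le) auto
  also have "\<dots> \<le> \<sigma> * c_coef \<alpha> \<sigma> lam \<tau> j 0"
    using c_coef_0_pos \<sigma>_bounds by (intro mult_right_mono) auto
  finally show ?thesis using True \<sigma>_bounds by simp
next
  case False
  then have s: "1 \<le> s" by simp
  have "c_coef \<alpha> \<sigma> lam \<tau> j (Suc s) \<le> lam ((real s + \<sigma>) * \<tau>) * a (Suc s)"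
    by (rule c_coef_Suc_le[OF assms])
  also have "\<dots> \<le> lam ((real s + \<sigma>) * \<tau>) * (a s + b (Suc s) - b s)"
    using a_diff_b_antimono[OF s] lam_node_pos[of "real s + \<sigma>"] assms \<sigma>_bounds
    by (intro mult_left_mono) auto
  also have "\<dots> \<le> c_coef \<alpha> \<sigma> lam \<tau> j s"
    using c_coef_ge[OF s] assms by simp
  finally show ?thesis .
qed

end
end

section \<open>Discrete energy inequalities\<close>

text \<open>Summation by parts: apart from the newest term, \<open>X s - E \<le> 0\<close> is
  multiplied by minus an increment of \<open>g\<close> (or minus \<open>g 0\<close>), which only
  increases the sum.\<close>

lemma weighted_telescope_ge:
  fixes g X :: "nat \<Rightarrow> real"
  assumes "0 \<le> g 0" "\<And>s. s < j \<Longrightarrow> g s \<le> g (Suc s)" "\<And>s. s \<le> j \<Longrightarrow> X s \<le> E"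
  shows "g j * (X (Suc j) - E) \<le> (\<Sum>s\<le>j. g s * (X (Suc s) - X s))"
  using assms
proof (induction j)
  case 0
  then show ?case by (simp add: mult_left_mono)
next
  case (Suc j)
  have "(g (Suc j) - g j) * (X (Suc j) - E) \<le> 0"
    using Suc.prems by (intro mult_nonneg_nonpos) auto
  moreover have "g j * (X (Suc j) - E) \<le> (\<Sum>s\<le>j. g s * (X (Suc s) - X s))"
    using Suc by simp
  ultimately show ?case by (simp add: algebra_simps)
qed

text \<open>With \<open>e s = v s - w\<close> the difference of the two sides is
  \<open>\<Sum> g s ((e s)\<^sup>2 - (e (s + 1))\<^sup>2)\<close>, whose last two terms dominate the rest.\<close>

lemma sigma_avg_energy:
  fixes g v :: "nat \<Rightarrow> real"
  assumes "1 / 2 < \<sigma>" "\<sigma> < 1" "0 \<le> g 0" "\<And>s. s < j \<Longrightarrow> g s \<le> g (Suc s)"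
    and "\<And>i. j = Suc i \<Longrightarrow> \<sigma> * g i \<le> (2 * \<sigma> - 1) * g j"
  shows "(\<Sum>s\<le>j. g s * ((v (Suc s))\<^sup>2 - (v s)\<^sup>2))
     \<le> 2 * (\<sigma> * v (Suc j) + (1 - \<sigma>) * v j) * (\<Sum>s\<le>j. g s * (v (Suc s) - v s))"
proof -
  define w where "w = \<sigma> * v (Suc j) + (1 - \<sigma>) * v j"
  define e where "e s = v s - w" for s
  define D where "D = v (Suc j) - v j"
  \<comment> \<open>Relative to \<open>w\<close>, the two newest levels are multiples of the single
    increment \<open>D\<close>, so the final comparison involves only the weights.\<close>
  have e1: "e (Suc j) = (1 - \<sigma>) * D" and e0: "e j = - (\<sigma> * D)"
    by (simp_all add: e_def w_def D_def algebra_simps)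
  have "2 * w * (\<Sum>s\<le>j. g s * (v (Suc s) - v s)) - (\<Sum>s\<le>j. g s * ((v (Suc s))\<^sup>2 - (v s)\<^sup>2))
      = (\<Sum>s\<le>j. g s * ((- (e (Suc s))\<^sup>2) - (- (e s)\<^sup>2)))"
    unfolding sum_distrib_left sum_subtractf[symmetric]
    by (rule sum.cong) (auto simp: e_def power2_eq_square algebra_simps)
  also have "\<dots> \<ge> 0"
  proof (cases j)
    case 0
    have "(1 - \<sigma>)\<^sup>2 * D\<^sup>2 \<le> \<sigma>\<^sup>2 * D\<^sup>2"
      using assms by (intro mult_right_mono power_mono) auto
    then show ?thesis using 0 assms e0 e1 by (simp add: power_mult_distrib)
  next
    case (Suc i)
    \<comment> \<open>The older levels are summed by parts with \<open>X s = - (e s)^2\<close> and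
      the upper bound 0.\<close>
    have "g i * (- (e (Suc i))\<^sup>2 - 0) \<le> (\<Sum>s\<le>i. g s * ((- (e (Suc s))\<^sup>2) - (- (e s)\<^sup>2)))"
      using assms Suc by (intro weighted_telescope_ge) auto
    moreover have "0 \<le> - g i * (e j)\<^sup>2 + g j * ((e j)\<^sup>2 - (e (Suc j))\<^sup>2)"
    proof -
      have "0 \<le> g m" if "m \<le> j" for m
        using that by (induction m) (use assms(3,4) in \<open>auto intro: order_trans\<close>)
      then have gi: "0 \<le> g i" using Suc by simp
      \<comment> \<open>As \<open>\<sigma>^2 - (1 - \<sigma>)^2 = 2 * \<sigma> - 1\<close>, the
        claim amounts to \<open>\<sigma>^2 * g i \<le> (2 * \<sigma> - 1) * g j\<close>, which
        follows from the assumption by \<open>\<sigma> < 1\<close>.\<close>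
      have "\<sigma> * (\<sigma> * g i) \<le> 1 * (\<sigma> * g i)"
        using assms gi by (intro mult_right_mono) auto
      then have "0 \<le> ((2 * \<sigma> - 1) * g j - \<sigma> * (\<sigma> * g i)) * D\<^sup>2"
        using assms(5)[OF Suc] by (intro mult_nonneg_nonneg) auto
      also have "\<dots> = - g i * (e j)\<^sup>2 + g j * ((e j)\<^sup>2 - (e (Suc j))\<^sup>2)"
        unfolding e0 e1 by (simp add: power2_eq_square algebra_simps)
      finally show ?thesis .
    qed
    ultimately show ?thesis using Suc by (simp add: algebra_simps)
  qed
  finally show ?thesis by (simp add: w_def)
qed

text \<open>Either the weighted average \<open>w\<close> of the last two levels is itself small, and then so is the
  new level because \<open>\<sigma> > 1/2\<close>, or the energy inequality applies. This makes no reference to the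
  size of the zeroth order coefficient \<open>q\<close>.\<close>

lemma level_bound_step:
  fixes g :: "nat \<Rightarrow> real" and V :: "nat \<Rightarrow> 'i \<Rightarrow> real" and \<sigma> :: real and j :: nat
  defines "w \<equiv> \<lambda>i. \<sigma> * V (Suc j) i + (1 - \<sigma>) * V j i"
  assumes \<sigma>: "1 / 2 < \<sigma>" "\<sigma> < 1" and g: "0 \<le> g 0" "\<And>s. s < j \<Longrightarrow> g s \<le> g (Suc s)" "0 < g j"
    and g': "\<And>i. j = Suc i \<Longrightarrow> \<sigma> * g i \<le> (2 * \<sigma> - 1) * g j"
    and E: "\<And>s. s \<le> j \<Longrightarrow> L2_set (V s) I \<le> E"
    and w: "L2_set w I \<le> (2 * \<sigma> - 1) * E \<or> (\<Sum>i\<in>I. w i * (\<Sum>s\<le>j. g s * (V (Suc s) i - V s i))) \<le> 0"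
  shows "L2_set (V (Suc j)) I \<le> E"
  using w
proof
  assume w: "L2_set w I \<le> (2 * \<sigma> - 1) * E"
  \<comment> \<open>The new level is recovered from \<open>w\<close> and \<open>V j\<close>; the
    bounds combine because \<open>(2 * \<sigma> - 1) + (1 - \<sigma>) = \<sigma>\<close>.\<close>
  have "\<sigma> * L2_set (V (Suc j)) I = L2_set (\<lambda>i. \<sigma> * V (Suc j) i) I"
    using \<sigma> by (simp add: L2_set_right_distrib)
  also have "\<dots> = L2_set (\<lambda>i. w i + (\<sigma> - 1) * V j i) I"
    by (simp add: w_def algebra_simps)
  also have "\<dots> \<le> L2_set w I + L2_set (\<lambda>i. (\<sigma> - 1) * V j i) I"
    by (rule L2_set_triangle_ineq)
  also have "L2_set (\<lambda>i. (\<sigma> - 1) * V j i) I = L2_set (\<lambda>i. (1 - \<sigma>) * V j i) I"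
    by (simp add: L2_set_def power_mult_distrib power2_commute)
  also have "\<dots> = (1 - \<sigma>) * L2_set (V j) I"
    using \<sigma> by (simp add: L2_set_right_distrib)
  also have "\<dots> \<le> (1 - \<sigma>) * E"
    using E \<sigma> by (intro mult_left_mono) auto
  finally have "\<sigma> * L2_set (V (Suc j)) I \<le> \<sigma> * E"
    using w by (simp add: algebra_simps)
  then show ?thesis using \<sigma> by simp
next
  assume w: "(\<Sum>i\<in>I. w i * (\<Sum>s\<le>j. g s * (V (Suc s) i - V s i))) \<le> 0"
  have E0: "0 \<le> E" using E[of 0] L2_set_nonneg[of "V 0" I] by linarith
  define X where "X s = (\<Sum>i\<in>I. (V s i)\<^sup>2)" for s
  have XL: "X s = (L2_set (V s) I)\<^sup>2" for s
    by (simp add: X_def L2_set_def sum_nonneg)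
  have "g j * (X (Suc j) - E\<^sup>2) \<le> (\<Sum>s\<le>j. g s * (X (Suc s) - X s))"
    using g E by (intro weighted_telescope_ge) (auto simp: XL power_mono)
  \<comment> \<open>Exchanging the sums lets the scalar energy inequality act on each component
    separately.\<close>
  also have "\<dots> = (\<Sum>i\<in>I. \<Sum>s\<le>j. g s * ((V (Suc s) i)\<^sup>2 - (V s i)\<^sup>2))"
    unfolding X_def by (subst sum.swap) (simp add: sum_subtractf flip: sum_distrib_left)
  also have "\<dots> \<le> (\<Sum>i\<in>I. 2 * w i * (\<Sum>s\<le>j. g s * (V (Suc s) i - V s i)))"
    unfolding w_def using \<sigma> g g' by (intro sum_mono sigma_avg_energy)
  also have "\<dots> = 2 * (\<Sum>i\<in>I. w i * (\<Sum>s\<le>j. g s * (V (Suc s) i - V s i)))"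
    by (simp add: sum_distrib_left mult_ac)
  also have "\<dots> \<le> 0" using w by simp
  finally have "X (Suc j) \<le> E\<^sup>2" using g(3) by (simp add: mult_le_0_iff)
  then show ?thesis unfolding XL using E0 by (simp add: power2_le_iff_abs_le)
qed

section \<open>Summation by parts and the compact average on grid functions vanishing at both
  ends\<close>

abbreviation diff2 :: "(nat \<Rightarrow> real) \<Rightarrow> nat \<Rightarrow> real" where
  "diff2 w i \<equiv> w (Suc i) - 2 * w i + w (i - 1)"

lemma sum_diff2:
  "(\<Sum>i=1..n. w i * diff2 w i)
     = - (\<Sum>i\<le>n. (w (Suc i) - w i)\<^sup>2) + w (Suc n) * (w (Suc n) - w n) - w 0 * (w 1 - w 0)"
  for w :: "nat \<Rightarrow> real"
  by (induction n) (auto simp: power2_eq_square algebra_simps)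

context
  fixes n :: nat and w :: "nat \<Rightarrow> real"
  assumes w: "w 0 = 0" "w (Suc n) = 0"
begin

definition dirichlet_sum where "dirichlet_sum = (\<Sum>i\<le>n. (w (Suc i) - w i)\<^sup>2)"

lemma dirichlet_sum_nonneg: "0 \<le> dirichlet_sum"
  by (simp add: dirichlet_sum_def sum_nonneg)

lemma sum_diff2_Dirichlet: "(\<Sum>i=1..n. w i * diff2 w i) = - dirichlet_sum"
  unfolding sum_diff2 using w by (simp add: dirichlet_sum_def)

lemma sum_diff2_sq_le: "(\<Sum>i=1..n. (diff2 w i)\<^sup>2) \<le> 4 * dirichlet_sum"
proof -
  have "(\<Sum>i=1..n. (diff2 w i)\<^sup>2) \<le> (\<Sum>i=1..n. 2 * (w (Suc i) - w i)\<^sup>2 + 2 * (w i - w (i - 1))\<^sup>2)"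
  proof (rule sum_mono)
    fix i
    have "0 \<le> ((w (Suc i) - w i) + (w i - w (i - 1)))\<^sup>2" by simp
    then show "(diff2 w i)\<^sup>2 \<le> 2 * (w (Suc i) - w i)\<^sup>2 + 2 * (w i - w (i - 1))\<^sup>2"
      by (simp add: power2_eq_square algebra_simps)
  qed
  also have "\<dots> = 2 * (\<Sum>i=1..n. (w (Suc i) - w i)\<^sup>2) + 2 * (\<Sum>i=1..n. (w i - w (i - 1))\<^sup>2)"
    by (simp add: sum.distrib sum_distrib_left)
  also have "(\<Sum>i=1..n. (w i - w (i - 1))\<^sup>2) = (\<Sum>i<n. (w (Suc i) - w i)\<^sup>2)"
    by (rule sum.reindex_bij_witness[of _ Suc "\<lambda>i. i - 1"]) auto
  also have "(\<Sum>i<n. (w (Suc i) - w i)\<^sup>2) \<le> dirichlet_sum"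
    unfolding dirichlet_sum_def by (rule sum_mono2) auto
  also have "(\<Sum>i=1..n. (w (Suc i) - w i)\<^sup>2) \<le> dirichlet_sum"
    unfolding dirichlet_sum_def by (rule sum_mono2) auto
  finally show ?thesis by simp
qed

text \<open>Each value is a telescoping sum of fewer than \<open>Suc n\<close> increments starting
  from the zero boundary value; Cauchy-Schwarz gives one factor \<open>Suc n\<close>, summation over
  i the other.\<close>

lemma discrete_Poincare: "(\<Sum>i=1..n. (w i)\<^sup>2) \<le> (real (Suc n))\<^sup>2 * dirichlet_sum"
proof -
  have "(w i)\<^sup>2 \<le> real (Suc n) * dirichlet_sum" if "i \<in> {1..n}" for i
  proof -
    have "w i = (\<Sum>m<i. w (Suc m) - w m)"
      using w by (simp add: sum_lessThan_telescope)
    then have "(w i)\<^sup>2 = (\<Sum>m<i. 1 * (w (Suc m) - w m))\<^sup>2" by simp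
    also have "\<dots> \<le> (\<Sum>m<i. 1\<^sup>2) * (\<Sum>m<i. (w (Suc m) - w m)\<^sup>2)"
      by (rule Cauchy_Schwarz_ineq_sum)
    also have "\<dots> \<le> real (Suc n) * dirichlet_sum"
      unfolding dirichlet_sum_def using that
      by (intro mult_mono sum_mono2) (auto intro: sum_nonneg)
    finally show ?thesis .
  qed
  then have "(\<Sum>i=1..n. (w i)\<^sup>2) \<le> (\<Sum>i=1..n. real (Suc n) * dirichlet_sum)"
    by (intro sum_mono) auto
  also have "\<dots> = real n * (real (Suc n) * dirichlet_sum)" by simp
  also have "\<dots> \<le> real (Suc n) * (real (Suc n) * dirichlet_sum)"
    using dirichlet_sum_nonneg by (intro mult_right_mono) auto
  finally show ?thesis by (simp add: power2_eq_square)
qed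

text \<open>The main part contributes minus the Dirichlet sum and the correction at most 4/12 of it,
  which leaves the factor 2/3; the Poincare inequality then absorbs the squared number of
  steps.\<close>

lemma compact_energy:
  "(\<Sum>i=1..n. (w i + diff2 w i / 12) * ((real (Suc n))\<^sup>2 * diff2 w i)) \<le> - (2/3) * (\<Sum>i=1..n. (w i)\<^sup>2)"
proof -
  have *: "(a + d / 12) * (c * d) = c * (a * d + d\<^sup>2 / 12)" for a c d :: real
    by (simp add: algebra_simps power2_eq_square)
  have "(\<Sum>i=1..n. (w i + diff2 w i / 12) * ((real (Suc n))\<^sup>2 * diff2 w i))
     = (real (Suc n))\<^sup>2 * ((\<Sum>i=1..n. w i * diff2 w i) + (\<Sum>i=1..n. (diff2 w i)\<^sup>2) / 12)"
    unfolding sum_divide_distrib sum.distrib[symmetric] sum_distrib_left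
    by (intro sum.cong refl *)
  also have "\<dots> \<le> (real (Suc n))\<^sup>2 * (- (2/3) * dirichlet_sum)"
    using sum_diff2_sq_le unfolding sum_diff2_Dirichlet by (intro mult_left_mono) (linarith, simp)
  also have "\<dots> = - (2/3) * ((real (Suc n))\<^sup>2 * dirichlet_sum)" by simp
  also have "\<dots> \<le> - (2/3) * (\<Sum>i=1..n. (w i)\<^sup>2)"
    using discrete_Poincare by simp
  finally show ?thesis .
qed

text \<open>In the expanded square the cross term is -1/6 of the Dirichlet sum, and the last term at
  most 4/144 of it.\<close>

lemma compact_sq_le: "(\<Sum>i=1..n. (w i + diff2 w i / 12)\<^sup>2) \<le> (\<Sum>i=1..n. (w i)\<^sup>2)"
proof -
  have *: "(a + d / 12)\<^sup>2 = a\<^sup>2 + a * d / 6 + d\<^sup>2 / 144" for a d :: real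
    by (simp add: algebra_simps power2_eq_square)
  have "(\<Sum>i=1..n. (w i + diff2 w i / 12)\<^sup>2)
     = (\<Sum>i=1..n. (w i)\<^sup>2) + (\<Sum>i=1..n. w i * diff2 w i) / 6 + (\<Sum>i=1..n. (diff2 w i)\<^sup>2) / 144"
    unfolding sum_divide_distrib sum.distrib[symmetric]
    by (intro sum.cong refl *)
  then show ?thesis using sum_diff2_sq_le dirichlet_sum_nonneg unfolding sum_diff2_Dirichlet by linarith
qed

text \<open>The Dirichlet sum is at most 4 times the sum of squares, so the product of
  \<open>w\<close> with its average keeps 2/3 of that sum. Young's inequality with weights 1/3 and
  3/4 takes another third, and the remaining third gives the factor 9/4.\<close>

lemma compact_sq_ge: "(\<Sum>i=1..n. (w i)\<^sup>2) \<le> 9/4 * (\<Sum>i=1..n. (w i + diff2 w i / 12)\<^sup>2)"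
proof -
  have "dirichlet_sum \<le> (\<Sum>i\<le>n. 2 * (w (Suc i))\<^sup>2 + 2 * (w i)\<^sup>2)"
    unfolding dirichlet_sum_def
  proof (rule sum_mono)
    fix i
    have "0 \<le> (w (Suc i) + w i)\<^sup>2" by simp
    then show "(w (Suc i) - w i)\<^sup>2 \<le> 2 * (w (Suc i))\<^sup>2 + 2 * (w i)\<^sup>2"
      by (simp add: power2_eq_square algebra_simps)
  qed
  also have "\<dots> = 2 * (\<Sum>i\<le>n. (w (Suc i))\<^sup>2) + 2 * (\<Sum>i\<le>n. (w i)\<^sup>2)"
    by (simp add: sum.distrib sum_distrib_left)
  also have "(\<Sum>i\<le>n. (w i)\<^sup>2) = (\<Sum>i=1..n. (w i)\<^sup>2)"
    using w by (intro sum.mono_neutral_right) (auto simp: not_less_eq_eq)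
  also have "(\<Sum>i\<le>n. (w (Suc i))\<^sup>2) = (\<Sum>i=1..Suc n. (w i)\<^sup>2)"
    by (rule sum.reindex_bij_witness[of _ "\<lambda>i. i - 1" Suc]) auto
  also have "\<dots> = (\<Sum>i=1..n. (w i)\<^sup>2)" using w by simp
  finally have dirichlet_sum: "dirichlet_sum \<le> 4 * (\<Sum>i=1..n. (w i)\<^sup>2)" by simp
  have "(\<Sum>i=1..n. (w i)\<^sup>2) - dirichlet_sum / 12 = (\<Sum>i=1..n. w i * (w i + diff2 w i / 12))"
    using sum_diff2_Dirichlet
    by (simp add: distrib_left sum.distrib power2_eq_square flip: sum_divide_distrib)
  also have "\<dots> \<le> (\<Sum>i=1..n. (w i)\<^sup>2 / 3 + 3/4 * (w i + diff2 w i / 12)\<^sup>2)"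
  proof (rule sum_mono)
    fix i
    have "a * c \<le> a\<^sup>2 / 3 + 3/4 * c\<^sup>2" for a c :: real
      using zero_le_power2[of "2 * a - 3 * c"] by (simp add: power2_eq_square algebra_simps)
    then show "w i * (w i + diff2 w i / 12) \<le> (w i)\<^sup>2 / 3 + 3/4 * (w i + diff2 w i / 12)\<^sup>2" .
  qed
  also have "\<dots> = (\<Sum>i=1..n. (w i)\<^sup>2) / 3 + 3/4 * (\<Sum>i=1..n. (w i + diff2 w i / 12)\<^sup>2)"
    by (simp only: sum.distrib sum_divide_distrib sum_distrib_left)
  finally show ?thesis using dirichlet_sum by simp
qed

end

section \<open>Truncation error in time\<close>

text \<open>The remainder carries \<open>fact n\<close> instead of \<open>fact (Suc n)\<close>; the
  constants in the estimates below are computed from this form.\<close>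

lemma Taylor_bounds:
  fixes f :: "nat \<Rightarrow> real \<Rightarrow> real"
  assumes "convex S" "\<And>i x. x \<in> S \<Longrightarrow> i \<le> n \<Longrightarrow> (f i has_real_derivative f (Suc i) x) (at x within S)"
    and "\<And>x. x \<in> S \<Longrightarrow> \<bar>f (Suc n) x\<bar> \<le> B" "w \<in> S" "w + d \<in> S"
  shows "\<bar>f 0 (w + d) - (\<Sum>i\<le>n. f i w * d ^ i / fact i)\<bar> \<le> B * \<bar>d\<bar> ^ Suc n / fact n"
  using field_Taylor[of S n f B w "w + d"] assms by simp

lemma Taylor_bound_0:
  fixes f0 f1 :: "real \<Rightarrow> real"
  assumes "convex S" "\<And>x. x \<in> S \<Longrightarrow> (f0 has_real_derivative f1 x) (at x within S)"
    and "\<And>x. x \<in> S \<Longrightarrow> \<bar>f1 x\<bar> \<le> B" "w \<in> S" "w + d \<in> S"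
  shows "\<bar>f0 (w + d) - f0 w\<bar> \<le> B * \<bar>d\<bar>"
  using Taylor_bounds[of S 0 "\<lambda>i. if i = 0 then f0 else f1" B w d] assms by simp

lemma Taylor_bound_1:
  fixes f0 f1 f2 :: "real \<Rightarrow> real"
  assumes "convex S" "\<And>x. x \<in> S \<Longrightarrow> (f0 has_real_derivative f1 x) (at x within S)"
    and "\<And>x. x \<in> S \<Longrightarrow> (f1 has_real_derivative f2 x) (at x within S)"
    and "\<And>x. x \<in> S \<Longrightarrow> \<bar>f2 x\<bar> \<le> B" "w \<in> S" "w + d \<in> S"
  shows "\<bar>f0 (w + d) - f0 w - f1 w * d\<bar> \<le> B * d\<^sup>2"
proof -
  define f where "f i = (if i = 0 then f0 else if i = 1 then f1 else f2)" for i :: nat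
  have "(f i has_real_derivative f (Suc i) x) (at x within S)" if "x \<in> S" "i \<le> 1" for i x
    using that assms by (cases "i = 0") (auto simp: f_def)
  from Taylor_bounds[of S 1 f B w d, OF assms(1) this] assms(4-) show ?thesis
    by (simp add: f_def power2_eq_square)
qed

lemma Taylor_bound_2:
  fixes f0 f1 f2 f3 :: "real \<Rightarrow> real"
  assumes "convex S" "\<And>x. x \<in> S \<Longrightarrow> (f0 has_real_derivative f1 x) (at x within S)"
    and "\<And>x. x \<in> S \<Longrightarrow> (f1 has_real_derivative f2 x) (at x within S)"
    and "\<And>x. x \<in> S \<Longrightarrow> (f2 has_real_derivative f3 x) (at x within S)"
    and "\<And>x. x \<in> S \<Longrightarrow> \<bar>f3 x\<bar> \<le> B" "w \<in> S" "w + d \<in> S"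
  shows "\<bar>f0 (w + d) - f0 w - f1 w * d - f2 w * d\<^sup>2 / 2\<bar> \<le> B * \<bar>d\<bar> ^ 3 / 2"
proof -
  define f where "f i = (if i = 0 then f0 else if i = 1 then f1 else if i = 2 then f2 else f3)" for i :: nat
  have "(f i has_real_derivative f (Suc i) x) (at x within S)" if "x \<in> S" "i \<le> 2" for i x
  proof -
    consider "i = 0" | "i = 1" | "i = 2" using \<open>i \<le> 2\<close> by linarith
    then show ?thesis using that assms by cases (auto simp: f_def)
  qed
  from Taylor_bounds[of S 2 f B w d, OF assms(1) this] assms(5-) show ?thesis
    by (simp add: f_def numeral_2_eq_2 numeral_3_eq_3 diff_diff_eq add.assoc)
qed

text \<open>Two orders are provided: the cubic one for the accuracy of a difference quotient, the
  quadratic one for products in which the other factor already supplies a power of the step. This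
  keeps surplus powers of the step out of the constants.\<close>

lemma central_difference_bound:
  fixes f0 f1 f2 f3 :: "real \<Rightarrow> real"
  assumes "convex S" "\<And>x. x \<in> S \<Longrightarrow> (f0 has_real_derivative f1 x) (at x within S)"
    and "\<And>x. x \<in> S \<Longrightarrow> (f1 has_real_derivative f2 x) (at x within S)"
    and "\<And>x. x \<in> S \<Longrightarrow> (f2 has_real_derivative f3 x) (at x within S)"
    and "\<And>x. x \<in> S \<Longrightarrow> \<bar>f2 x\<bar> \<le> B" "\<And>x. x \<in> S \<Longrightarrow> \<bar>f3 x\<bar> \<le> B"
    and "w \<in> S" "w + d \<in> S" "w - d \<in> S" "0 < d"
  shows "\<bar>f1 w * (2 * d) - (f0 (w + d) - f0 (w - d))\<bar> \<le> B * d ^ 3"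
    and "\<bar>f1 w * (2 * d) - (f0 (w + d) - f0 (w - d))\<bar> \<le> 2 * (B * d\<^sup>2)"
proof -
  have 1: "\<bar>f0 (w + d) - f0 w - f1 w * d - f2 w * d\<^sup>2 / 2\<bar> \<le> B * d ^ 3 / 2"
    using Taylor_bound_2[OF assms(1-4,6,7,8)] assms by simp
  have 2: "\<bar>f0 (w - d) - f0 w + f1 w * d - f2 w * d\<^sup>2 / 2\<bar> \<le> B * d ^ 3 / 2"
    using Taylor_bound_2[OF assms(1-4,6,7), of "- d"] assms by simp
  show "\<bar>f1 w * (2 * d) - (f0 (w + d) - f0 (w - d))\<bar> \<le> B * d ^ 3"
    using 1 2 by linarith
  have 3: "\<bar>f0 (w + d) - f0 w - f1 w * d\<bar> \<le> B * d\<^sup>2"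
    using Taylor_bound_1[OF assms(1-3,5,7,8)] by simp
  have 4: "\<bar>f0 (w - d) - f0 w + f1 w * d\<bar> \<le> B * d\<^sup>2"
    using Taylor_bound_1[OF assms(1-3,5,7), of "- d"] assms by simp
  show "\<bar>f1 w * (2 * d) - (f0 (w + d) - f0 (w - d))\<bar> \<le> 2 * (B * d\<^sup>2)"
    using 3 4 by linarith
qed

text \<open>The case \<open>b = t\<close> is included: the integrand is singular there, but the
  antiderivative stays continuous, so differentiability in the open interval suffices.\<close>

lemma kernel_has_integral:
  fixes \<alpha> t a b :: real
  assumes "0 < \<alpha>" "\<alpha> < 1" "a \<le> b" "b \<le> t"
  shows "((\<lambda>\<eta>. (t - \<eta>) powr (-\<alpha>)) has_integral ((t - a) powr (1 - \<alpha>) - (t - b) powr (1 - \<alpha>)) / (1 - \<alpha>)) {a..b}"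
proof -
  have "((\<lambda>\<eta>. (t - \<eta>) powr (-\<alpha>)) has_integral
      (- ((t - b) powr (1 - \<alpha>) / (1 - \<alpha>))) - (- ((t - a) powr (1 - \<alpha>) / (1 - \<alpha>)))) {a..b}"
  proof (rule fundamental_theorem_of_calculus_interior[OF assms(3)])
    show "continuous_on {a..b} (\<lambda>\<eta>. - ((t - \<eta>) powr (1 - \<alpha>) / (1 - \<alpha>)))"
      using assms by (intro continuous_intros continuous_on_powr') auto
    fix \<eta> assume "\<eta> \<in> {a<..<b}"
    then have "0 < t - \<eta>" using assms by auto
    then show "((\<lambda>\<eta>. - ((t - \<eta>) powr (1 - \<alpha>) / (1 - \<alpha>))) has_vector_derivative (t - \<eta>) powr (-\<alpha>)) (at \<eta>)"
      unfolding has_real_derivative_iff_has_vector_derivative[symmetric]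
      using assms by (auto intro!: derivative_eq_intros)
  qed
  then show ?thesis by (simp add: diff_divide_distrib)
qed

text \<open>Writing \<open>\<eta> - m = (t - m) - (t - \<eta>)\<close> splits the moment into two
  pure powers of \<open>t - \<eta>\<close>.\<close>

lemma kernel_moment_has_integral:
  fixes \<alpha> t a b m :: real
  assumes "0 < \<alpha>" "\<alpha> < 1" "a \<le> b" "b \<le> t"
  shows "((\<lambda>\<eta>. (\<eta> - m) * (t - \<eta>) powr (-\<alpha>)) has_integral
     ((t - b) powr (2 - \<alpha>) - (t - a) powr (2 - \<alpha>)) / (2 - \<alpha>)
     + (t - m) * (((t - a) powr (1 - \<alpha>) - (t - b) powr (1 - \<alpha>)) / (1 - \<alpha>))) {a..b}"
proof -
  define P where "P \<eta> = (t - \<eta>) powr (2 - \<alpha>) / (2 - \<alpha>) - (t - m) * ((t - \<eta>) powr (1 - \<alpha>) / (1 - \<alpha>))" for \<eta>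
  have "((\<lambda>\<eta>. (\<eta> - m) * (t - \<eta>) powr (-\<alpha>)) has_integral P b - P a) {a..b}"
  proof (rule fundamental_theorem_of_calculus_interior[OF assms(3)])
    show "continuous_on {a..b} P" unfolding P_def
      using assms by (intro continuous_intros continuous_on_powr') auto
    fix \<eta> assume "\<eta> \<in> {a<..<b}"
    then have pos: "0 < t - \<eta>" using assms by auto
    have "(P has_real_derivative - ((t - \<eta>) powr (1 - \<alpha>)) + (t - m) * (t - \<eta>) powr (-\<alpha>)) (at \<eta>)"
      unfolding P_def using assms pos by (auto intro!: derivative_eq_intros)
    also have "(t - \<eta>) powr (1 - \<alpha>) = (t - \<eta>) * (t - \<eta>) powr (-\<alpha>)"
      using pos powr_add[of "t - \<eta>" 1 "-\<alpha>"] by simp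
    also have "- ((t - \<eta>) * (t - \<eta>) powr (-\<alpha>)) + (t - m) * (t - \<eta>) powr (-\<alpha>) = (\<eta> - m) * (t - \<eta>) powr (-\<alpha>)"
      by (simp add: algebra_simps)
    finally show "(P has_vector_derivative (\<eta> - m) * (t - \<eta>) powr (-\<alpha>)) (at \<eta>)"
      unfolding has_real_derivative_iff_has_vector_derivative .
  qed
  then show ?thesis by (simp add: P_def diff_divide_distrib algebra_simps)
qed

lemma continuous_times_kernel_integrable:
  fixes \<alpha> t a b :: real
  assumes "0 < \<alpha>" "\<alpha> < 1" "a \<le> b" "b \<le> t" "continuous_on {a..b} g"
  shows "(\<lambda>\<eta>. g \<eta> * (t - \<eta>) powr (-\<alpha>)) integrable_on {a..b}"
proof -
  have "(\<lambda>\<eta>. (t - \<eta>) powr (-\<alpha>)) absolutely_integrable_on {a..b}"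
    using kernel_has_integral[OF assms(1-4)] by (intro nonnegative_absolutely_integrable_1) auto
  moreover have "g \<in> borel_measurable (lebesgue_on {a..b})"
    using assms(5) by (intro continuous_imp_measurable_on_sets_lebesgue) auto
  moreover have "bounded (g ` {a..b})"
    using assms(5) by (intro compact_imp_bounded compact_continuous_image) auto
  ultimately have "(\<lambda>\<eta>. g \<eta> * (t - \<eta>) powr (-\<alpha>)) absolutely_integrable_on {a..b}"
    by (intro absolutely_integrable_bounded_measurable_product_real) auto
  then show ?thesis by (rule set_lebesgue_integral_eq_integral)
qed

text \<open>A uniform affine approximation of the smooth factor costs its error times the kernel
  mass \<open>I\<close>. Since the kernel is integrated exactly, its singularity does not lower the
  order.\<close>

lemma integral_kernel_approx:
  fixes \<alpha> t a b m :: real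
  assumes "0 < \<alpha>" "\<alpha> < 1" "a \<le> b" "b \<le> t" "continuous_on {a..b} g"
    and approx: "\<And>\<eta>. \<eta> \<in> {a..b} \<Longrightarrow> \<bar>g \<eta> - (A + c * (\<eta> - m))\<bar> \<le> \<epsilon>"
    and I: "((\<lambda>\<eta>. (t - \<eta>) powr (-\<alpha>)) has_integral I) {a..b}"
    and J: "((\<lambda>\<eta>. (\<eta> - m) * (t - \<eta>) powr (-\<alpha>)) has_integral J) {a..b}"
  shows "\<bar>integral {a..b} (\<lambda>\<eta>. g \<eta> * (t - \<eta>) powr (-\<alpha>)) - (A * I + c * J)\<bar> \<le> \<epsilon> * I"
proof -
  let ?K = "\<lambda>\<eta>. (t - \<eta>) powr (-\<alpha>)"
  have int: "(\<lambda>\<eta>. g \<eta> * ?K \<eta>) integrable_on {a..b}"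
    by (rule continuous_times_kernel_integrable[OF assms(1-5)])
  have "((\<lambda>\<eta>. A * ?K \<eta> + c * ((\<eta> - m) * ?K \<eta>)) has_integral A * I + c * J) {a..b}"
    by (intro has_integral_add has_integral_mult_right I J)
  then have d: "((\<lambda>\<eta>. g \<eta> * ?K \<eta> - (A * ?K \<eta> + c * ((\<eta> - m) * ?K \<eta>))) has_integral
      integral {a..b} (\<lambda>\<eta>. g \<eta> * ?K \<eta>) - (A * I + c * J)) {a..b}"
    using integrable_integral[OF int] by (intro has_integral_diff)
  have "\<bar>g \<eta> * ?K \<eta> - (A * ?K \<eta> + c * ((\<eta> - m) * ?K \<eta>))\<bar> \<le> \<epsilon> * ?K \<eta>" if "\<eta> \<in> {a..b}" for \<eta>
  proof -
    have "g \<eta> * ?K \<eta> - (A * ?K \<eta> + c * ((\<eta> - m) * ?K \<eta>)) = (g \<eta> - (A + c * (\<eta> - m))) * ?K \<eta>"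
      by (simp add: algebra_simps)
    then have "\<bar>g \<eta> * ?K \<eta> - (A * ?K \<eta> + c * ((\<eta> - m) * ?K \<eta>))\<bar> = \<bar>g \<eta> - (A + c * (\<eta> - m))\<bar> * ?K \<eta>"
      by (simp add: abs_mult)
    then show ?thesis using approx[OF that] by (simp add: mult_right_mono)
  qed
  then have "norm (integral {a..b} (\<lambda>\<eta>. g \<eta> * ?K \<eta> - (A * ?K \<eta> + c * ((\<eta> - m) * ?K \<eta>))))
      \<le> integral {a..b} (\<lambda>\<eta>. \<epsilon> * ?K \<eta>)"
    using d has_integral_mult_right[OF I, of \<epsilon>]
    by (intro integral_norm_bound_integral) auto
  then show ?thesis
    unfolding integral_unique[OF d] integral_unique[OF has_integral_mult_right[OF I, of \<epsilon>]] by simp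
qed

text \<open>A quotient \<open>\<delta> s\<close> enters the interpolants of two neighbouring cells,
  as the own quotient of one and the next quotient of the other, whence the two \<open>b\<close>
  terms in \<open>c\<close>. Regrouping by cell exposes an \<open>a\<close> term and a slope term
  for every full cell and an \<open>a\<close> term alone for the last.\<close>

lemma (in caputo_exponent) c_coef_sum:
  fixes \<tau> :: real and lam :: "real \<Rightarrow> real" and \<delta> :: "nat \<Rightarrow> real"
  defines "L \<equiv> \<lambda>r. lam (r * \<tau>)"
  shows "(\<Sum>s\<le>j. c_coef \<alpha> \<sigma> lam \<tau> j (j - s) * \<delta> s) =
    (\<Sum>i<j. L (real (j - i) + \<sigma> - 1/2) * a (j - i) * \<delta> i
        + b (j - i) * (L (real (j - i) - 1 + \<sigma>) * \<delta> (Suc i) - L (real (j - i) + \<sigma>) * \<delta> i))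
    + L (\<sigma> - 1/2) * a 0 * \<delta> j"
proof -
  have "(\<Sum>s\<le>j. c_coef \<alpha> \<sigma> lam \<tau> j (j - s) * \<delta> s) =
      (\<Sum>s\<le>j. L (real (j - s) + \<sigma> - 1/2) * a (j - s) * \<delta> s)
    + (\<Sum>s\<le>j. if 1 \<le> s then L (real (j - s) + \<sigma>) * b (Suc (j - s)) * \<delta> s else 0)
    - (\<Sum>s\<le>j. if s < j then L (real (j - s) + \<sigma>) * b (j - s) * \<delta> s else 0)"
    unfolding sum.distrib[symmetric] sum_subtractf[symmetric]
    by (intro sum.cong refl, subst c_coef_eq) (auto simp: L_def algebra_simps)
  also have "(\<Sum>s\<le>j. if s < j then L (real (j - s) + \<sigma>) * b (j - s) * \<delta> s else 0)
      = (\<Sum>i<j. L (real (j - i) + \<sigma>) * b (j - i) * \<delta> i)"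
    by (intro sum.mono_neutral_cong_right) auto
  also have "(\<Sum>s\<le>j. if 1 \<le> s then L (real (j - s) + \<sigma>) * b (Suc (j - s)) * \<delta> s else 0)
      = (\<Sum>s=1..j. L (real (j - s) + \<sigma>) * b (Suc (j - s)) * \<delta> s)"
    by (intro sum.mono_neutral_cong_right) auto
  also have "\<dots> = (\<Sum>i<j. L (real (j - i) - 1 + \<sigma>) * b (j - i) * \<delta> (Suc i))"
    by (rule sum.reindex_bij_witness[of _ Suc "\<lambda>i. i - 1"])
       (auto simp: of_nat_diff Suc_diff_le algebra_simps)
  also have "(\<Sum>s\<le>j. L (real (j - s) + \<sigma> - 1/2) * a (j - s) * \<delta> s)
      = (\<Sum>i<j. L (real (j - i) + \<sigma> - 1/2) * a (j - i) * \<delta> i) + L (\<sigma> - 1/2) * a 0 * \<delta> j"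
    by (simp flip: lessThan_Suc_atMost)
  finally show ?thesis
    by (simp add: sum.distrib sum_subtractf right_diff_distrib algebra_simps)
qed

section \<open>Truncation error of the discrete derivative for one function of time\<close>

locale caputo_truncation = caputo_exponent +
  fixes T :: real and lam l1 l2 v v1 v2 v3 :: "real \<Rightarrow> real" and C :: real
  assumes lam: "\<And>s. s \<in> {0..T} \<Longrightarrow> (lam has_real_derivative l1 s) (at s within {0..T})"
    and l1: "\<And>s. s \<in> {0..T} \<Longrightarrow> (l1 has_real_derivative l2 s) (at s within {0..T})"
    and v: "\<And>s. s \<in> {0..T} \<Longrightarrow> (v has_real_derivative v1 s) (at s within {0..T})"
    and v1: "\<And>s. s \<in> {0..T} \<Longrightarrow> (v1 has_real_derivative v2 s) (at s within {0..T})"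
    and v2: "\<And>s. s \<in> {0..T} \<Longrightarrow> (v2 has_real_derivative v3 s) (at s within {0..T})"
    and C: "\<And>s. s \<in> {0..T} \<Longrightarrow> \<bar>lam s\<bar> \<le> C" "\<And>s. s \<in> {0..T} \<Longrightarrow> \<bar>l1 s\<bar> \<le> C"
      "\<And>s. s \<in> {0..T} \<Longrightarrow> \<bar>l2 s\<bar> \<le> C" "\<And>s. s \<in> {0..T} \<Longrightarrow> \<bar>v1 s\<bar> \<le> C"
      "\<And>s. s \<in> {0..T} \<Longrightarrow> \<bar>v2 s\<bar> \<le> C" "\<And>s. s \<in> {0..T} \<Longrightarrow> \<bar>v3 s\<bar> \<le> C"
begin

context
  fixes \<tau> :: real and j :: nat and t :: real
  assumes \<tau>: "0 < \<tau>" and jT: "(real j + 1) * \<tau> \<le> T" and t: "t = (real j + \<sigma>) * \<tau>"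
begin

lemma t_in: "0 < t" "t \<le> T"
proof -
  show "0 < t" using \<tau> \<sigma>_bounds by (simp add: t add_nonneg_pos)
  have "t \<le> (real j + 1) * \<tau>" unfolding t using \<tau> \<sigma>_bounds by (intro mult_right_mono) auto
  then show "t \<le> T" using jT by simp
qed

lemma time_in: "0 \<le> r \<Longrightarrow> r \<le> real j + 1 \<Longrightarrow> r * \<tau> \<in> {0..T}"
  using order_trans[OF mult_right_mono[of r "real j + 1" \<tau>] jT] \<tau> by auto

definition g where "g \<eta> = lam (t - \<eta>) * v1 \<eta>"
definition g1 where "g1 \<eta> = lam (t - \<eta>) * v2 \<eta> - l1 (t - \<eta>) * v1 \<eta>"

lemma reflected_deriv:
  assumes "\<And>s. s \<in> {0..T} \<Longrightarrow> (F has_real_derivative F' s) (at s within {0..T})" "\<eta> \<in> {0..t}"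
  shows "((\<lambda>\<eta>. F (t - \<eta>)) has_real_derivative - F' (t - \<eta>)) (at \<eta> within {0..t})"
proof -
  have "(F has_real_derivative F' (t - \<eta>)) (at (t - \<eta>) within (\<lambda>\<eta>. t - \<eta>) ` {0..t})"
    using t_in assms by (intro DERIV_subset[OF assms(1)]) auto
  moreover have "((\<lambda>\<eta>. t - \<eta>) has_real_derivative -1) (at \<eta> within {0..t})"
    by (auto intro!: derivative_eq_intros)
  ultimately show ?thesis using DERIV_image_chain[of F _ "\<lambda>\<eta>. t - \<eta>"] by (fastforce simp: o_def)
qed

lemma deriv_restrict:
  assumes "\<And>s. s \<in> {0..T} \<Longrightarrow> (F has_real_derivative F' s) (at s within {0..T})" "\<eta> \<in> {0..t}"
  shows "(F has_real_derivative F' \<eta>) (at \<eta> within {0..t})"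
  using t_in assms by (intro DERIV_subset[OF assms(1)]) auto

lemma g_deriv: "\<eta> \<in> {0..t} \<Longrightarrow> (g has_real_derivative g1 \<eta>) (at \<eta> within {0..t})"
  unfolding g_def g1_def
  by (rule derivative_eq_intros reflected_deriv[OF lam] deriv_restrict[OF v1] refl | assumption)+ simp

lemma g1_deriv:
  "\<eta> \<in> {0..t} \<Longrightarrow> (g1 has_real_derivative
     lam (t - \<eta>) * v3 \<eta> - 2 * l1 (t - \<eta>) * v2 \<eta> + l2 (t - \<eta>) * v1 \<eta>) (at \<eta> within {0..t})"
  unfolding g1_def
  by (rule derivative_eq_intros reflected_deriv[OF lam] reflected_deriv[OF l1] deriv_restrict[OF v1]
      deriv_restrict[OF v2] refl | assumption)+ (simp add: algebra_simps)

lemma g_continuous: "continuous_on {0..t} g"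
  using g_deriv by (intro DERIV_continuous_on)

lemma abs_mult_le: "\<bar>x\<bar> \<le> X \<Longrightarrow> \<bar>y\<bar> \<le> Y \<Longrightarrow> \<bar>x * y\<bar> \<le> X * (Y::real)"
  by (simp add: abs_mult mult_mono')

lemma g_Taylor:
  assumes "m \<in> {0..t}" "\<eta> \<in> {0..t}"
  shows "\<bar>g \<eta> - (g m + g1 m * (\<eta> - m))\<bar> \<le> 4 * C\<^sup>2 * (\<eta> - m)\<^sup>2"
proof -
  have "\<bar>lam (t - \<eta>) * v3 \<eta> - 2 * l1 (t - \<eta>) * v2 \<eta> + l2 (t - \<eta>) * v1 \<eta>\<bar> \<le> 4 * C\<^sup>2" if "\<eta> \<in> {0..t}" for \<eta>
  proof -
    have in': "t - \<eta> \<in> {0..T}" "\<eta> \<in> {0..T}" using that t_in by auto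
    have "\<bar>lam (t - \<eta>) * v3 \<eta>\<bar> \<le> C * C" "\<bar>l1 (t - \<eta>) * v2 \<eta>\<bar> \<le> C * C" "\<bar>l2 (t - \<eta>) * v1 \<eta>\<bar> \<le> C * C"
      using C in' by (auto intro!: abs_mult_le)
    then show ?thesis unfolding power2_eq_square by linarith
  qed
  from Taylor_bound_1[OF _ g_deriv g1_deriv this, of m "\<eta> - m"] assms show ?thesis
    by (simp add: diff_diff_eq)
qed

abbreviation mid where "mid i \<equiv> (real i + 1/2) * \<tau>"
abbreviation \<delta> where "\<delta> i \<equiv> (v (real (Suc i) * \<tau>) - v (real i * \<tau>)) / \<tau>"

text \<open>The cell is symmetric about \<open>mid i\<close>, so the quotient is a central
  difference with half step \<open>\<tau> / 2\<close>. For \<open>i = j\<close> it reaches the level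
  j + 1 beyond \<open>t\<close>, which is covered by
  \<open>(real j + 1) * \<tau> \<le> T\<close>.\<close>

lemma delta_mid:
  assumes "i \<le> j"
  shows "\<bar>v1 (mid i) - \<delta> i\<bar> \<le> C * \<tau>\<^sup>2 / 8" "\<bar>v1 (mid i) - \<delta> i\<bar> \<le> C * \<tau> / 2"
proof -
  have m: "mid i \<in> {0..T}" "mid i + \<tau> / 2 \<in> {0..T}" "mid i - \<tau> / 2 \<in> {0..T}"
    using time_in[of "real i + 1/2"] time_in[of "real i + 1"] time_in[of "real i"] assms
    by (auto simp: algebra_simps)
  have e: "mid i + \<tau> / 2 = real (Suc i) * \<tau>" "mid i - \<tau> / 2 = real i * \<tau>"
    by (auto simp: algebra_simps)
  have d: "v1 (mid i) - \<delta> i = (v1 (mid i) * (2 * (\<tau> / 2)) - (v (mid i + \<tau> / 2) - v (mid i - \<tau> / 2))) / \<tau>"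
    unfolding e using \<tau> by (simp add: field_simps)
  note D = central_difference_bound[OF _ v v1 v2 C(5,6) m]
  have "\<bar>v1 (mid i) * (2 * (\<tau> / 2)) - (v (mid i + \<tau> / 2) - v (mid i - \<tau> / 2))\<bar> \<le> C * (\<tau> / 2) ^ 3"
    using \<tau> by (intro D(1)) auto
  also have "\<dots> = C * \<tau>\<^sup>2 / 8 * \<tau>" by (simp add: power_divide power2_eq_square power3_eq_cube)
  finally show "\<bar>v1 (mid i) - \<delta> i\<bar> \<le> C * \<tau>\<^sup>2 / 8"
    unfolding d using \<tau> by (simp add: abs_divide divide_le_eq)
  have "\<bar>v1 (mid i) * (2 * (\<tau> / 2)) - (v (mid i + \<tau> / 2) - v (mid i - \<tau> / 2))\<bar> \<le> 2 * (C * (\<tau> / 2)\<^sup>2)"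
    using \<tau> by (intro D(2)) auto
  also have "\<dots> = C * \<tau> / 2 * \<tau>" by (simp add: power_divide power2_eq_square)
  finally show "\<bar>v1 (mid i) - \<delta> i\<bar> \<le> C * \<tau> / 2"
    unfolding d using \<tau> by (simp add: abs_divide divide_le_eq)
qed

text \<open>Approximates \<open>\<tau> * g1 (mid i)\<close>: the two values of \<open>lam\<close>
  belong to the ends of cell i, whereas the two quotients are centred at the midpoints of the cells
  i and i + 1.\<close>

abbreviation slope where
  "slope i \<equiv> lam (t - real (Suc i) * \<tau>) * \<delta> (Suc i) - lam (t - real i * \<tau>) * \<delta> i"

lemma mid_in: "i \<le> j \<Longrightarrow> mid i \<in> {0..t}"
  unfolding t using \<tau> \<sigma>_bounds by (auto intro!: mult_right_mono)

lemma slope_bound: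
  assumes "i < j"
  shows "\<bar>slope i - \<tau> * g1 (mid i)\<bar> \<le> 11/4 * C\<^sup>2 * \<tau>\<^sup>2"
proof -
  define p r l l' where "p = lam (t - real (Suc i) * \<tau>)" and "r = lam (t - real i * \<tau>)"
    and "l = lam (t - mid i)" and "l' = l1 (t - mid i)"
  define x y d e where "x = v1 (mid i)" and "y = v2 (mid i)" and "d = \<delta> i" and "e = \<delta> (Suc i)"
  have m: "mid i \<in> {0..T}" "mid i + \<tau> \<in> {0..T}"
    using time_in[of "real i + 1/2"] time_in[of "real i + 1/2 + 1"] assms
    by (auto simp: algebra_simps)
  have tm: "t - mid i \<in> {0..T}" using mid_in[of i] assms t_in by auto
  have "real i * \<tau> \<le> t" "real (Suc i) * \<tau> \<le> t"
    unfolding t using assms \<tau> \<sigma>_bounds by (auto intro!: mult_right_mono)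
  then have tn: "t - mid i + \<tau> / 2 \<in> {0..T}" "t - mid i + (- \<tau> / 2) \<in> {0..T}"
    using \<tau> t_in by (auto simp: algebra_simps add_nonneg_nonneg intro: order_trans)
  have e1: "t - mid i + \<tau> / 2 = t - real i * \<tau>" "t - mid i + (- \<tau> / 2) = t - real (Suc i) * \<tau>"
    by (auto simp: algebra_simps)
  have P: "\<bar>p - l + l' * \<tau> / 2\<bar> \<le> C * \<tau>\<^sup>2 / 4" "\<bar>p - l\<bar> \<le> C * \<tau> / 2"
    using Taylor_bound_1[OF _ lam l1 C(3) tm tn(2)] Taylor_bound_0[OF _ lam C(2) tm tn(2)] \<tau>
    unfolding e1 by (simp_all add: p_def l_def l'_def power_divide)
  have R: "\<bar>r - l - l' * \<tau> / 2\<bar> \<le> C * \<tau>\<^sup>2 / 4" "\<bar>r - l\<bar> \<le> C * \<tau> / 2"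
    using Taylor_bound_1[OF _ lam l1 C(3) tm tn(1)] Taylor_bound_0[OF _ lam C(2) tm tn(1)] \<tau>
    unfolding e1 by (simp_all add: r_def l_def l'_def power_divide)
  have PR: "\<bar>p - r\<bar> \<le> C * \<tau>" "\<bar>p - r + l' * \<tau>\<bar> \<le> C * \<tau>\<^sup>2 / 2"
    using P R by linarith+
  have "mid (Suc i) = mid i + \<tau>" by (simp add: algebra_simps)
  define z where "z = v1 (mid i + \<tau>)"
  have dx: "\<bar>x - d\<bar> \<le> C * \<tau>\<^sup>2 / 8" "\<bar>x - d\<bar> \<le> C * \<tau> / 2"
    using delta_mid[of i] assms by (simp_all add: x_def d_def)
  have "\<bar>z - e\<bar> \<le> C * \<tau>\<^sup>2 / 8" 
    using delta_mid(1)[of "Suc i"] assms \<open>mid (Suc i) = mid i + \<tau>\<close> by (simp add: e_def z_def)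
  moreover have "\<bar>z - x - y * \<tau>\<bar> \<le> C * \<tau>\<^sup>2"
    using Taylor_bound_1[OF _ v1 v2 C(6) m] by (simp add: x_def y_def z_def)
  ultimately have "\<bar>e - d - y * \<tau>\<bar> \<le> C * \<tau>\<^sup>2 + C * \<tau>\<^sup>2 / 8 + C * \<tau>\<^sup>2 / 8"
    using dx(1) by (smt (verit))
  moreover have "C * \<tau>\<^sup>2 + C * \<tau>\<^sup>2 / 8 + C * \<tau>\<^sup>2 / 8 = 5/4 * C * \<tau>\<^sup>2" by simp
  ultimately have E: "\<bar>e - d - y * \<tau>\<bar> \<le> 5/4 * C * \<tau>\<^sup>2" by (simp only:)
  have "slope i - \<tau> * g1 (mid i) = p * e - r * d - \<tau> * (l * y - l' * x)"
    by (simp add: g1_def p_def r_def l_def l'_def x_def y_def d_def e_def)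
  \<comment> \<open>A discrete product rule. In every summand the bounds of the two factors multiply
    to a constant times \<open>C^2 * \<tau>^2\<close>; for the third one the coarse bound on
    \<open>d - x\<close> is enough.\<close>
  also have "\<dots> = p * (e - d - y * \<tau>) + (p - l) * (y * \<tau>) + (p - r) * (d - x) + (p - r + l' * \<tau>) * x"
    by (simp add: algebra_simps)
  finally have eq: "slope i - \<tau> * g1 (mid i) = \<dots>" .
  have "\<bar>p\<bar> \<le> C" using C(1)[OF tn(2)] unfolding e1 p_def .
  then have "\<bar>p * (e - d - y * \<tau>)\<bar> \<le> C * (5/4 * C * \<tau>\<^sup>2)" using E by (rule abs_mult_le)
  moreover have "\<bar>(p - l) * (y * \<tau>)\<bar> \<le> (C * \<tau> / 2) * (C * \<tau>)"
    using P C(5)[OF m(1)] \<tau> by (intro abs_mult_le) (auto simp: y_def)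
  moreover have "\<bar>(p - r) * (d - x)\<bar> \<le> (C * \<tau>) * (C * \<tau> / 2)"
    using PR dx by (intro abs_mult_le) (auto simp: abs_minus_commute)
  moreover have "\<bar>(p - r + l' * \<tau>) * x\<bar> \<le> (C * \<tau>\<^sup>2 / 2) * C"
    using PR C(4)[OF m(1)] by (intro abs_mult_le) (auto simp: x_def)
  ultimately have "\<bar>slope i - \<tau> * g1 (mid i)\<bar> \<le>
     C * (5/4 * C * \<tau>\<^sup>2) + (C * \<tau> / 2) * (C * \<tau>) + (C * \<tau>) * (C * \<tau> / 2) + (C * \<tau>\<^sup>2 / 2) * C"
    unfolding eq by linarith
  also have "\<dots> = 11/4 * C\<^sup>2 * \<tau>\<^sup>2" by (simp add: power2_eq_square)
  finally show ?thesis .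
qed

text \<open>Uniform error of the interpolant on a full cell: 9/8 for the midpoint value and
  curvature, plus half of 11/4 for the slope at distance at most \<open>\<tau> / 2\<close> from the
  midpoint.\<close>

definition \<epsilon> where "\<epsilon> = 5/2 * C\<^sup>2 * \<tau>\<^sup>2"

lemma g_approx_const:
  assumes "i \<le> j" "\<eta> \<in> {0..t}" "\<bar>\<eta> - mid i\<bar> \<le> \<tau> / 2"
  shows "\<bar>g \<eta> - (lam (t - mid i) * \<delta> i + g1 (mid i) * (\<eta> - mid i))\<bar> \<le> 9/8 * C\<^sup>2 * \<tau>\<^sup>2"
proof -
  have m: "mid i \<in> {0..t}" by (rule mid_in[OF assms(1)])
  have "(\<eta> - mid i)\<^sup>2 \<le> (\<tau> / 2)\<^sup>2" using assms(3) by (simp add: abs_le_square_iff[symmetric])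
  then have "4 * C\<^sup>2 * (\<eta> - mid i)\<^sup>2 \<le> 4 * C\<^sup>2 * (\<tau> / 2)\<^sup>2" by (intro mult_left_mono) auto
  then have 1: "\<bar>g \<eta> - (g (mid i) + g1 (mid i) * (\<eta> - mid i))\<bar> \<le> C\<^sup>2 * \<tau>\<^sup>2"
    using g_Taylor[OF m assms(2)] by (simp add: power_divide)
  have "\<bar>lam (t - mid i) * (v1 (mid i) - \<delta> i)\<bar> \<le> C * (C * \<tau>\<^sup>2 / 8)"
    using m t_in by (intro abs_mult_le C delta_mid assms) auto
  then have "\<bar>g (mid i) - lam (t - mid i) * \<delta> i\<bar> \<le> C\<^sup>2 * \<tau>\<^sup>2 / 8"
    by (simp add: g_def right_diff_distrib power2_eq_square)
  with 1 have "\<bar>(g \<eta> - (g (mid i) + g1 (mid i) * (\<eta> - mid i))) + (g (mid i) - lam (t - mid i) * \<delta> i)\<bar>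
      \<le> C\<^sup>2 * \<tau>\<^sup>2 + C\<^sup>2 * \<tau>\<^sup>2 / 8"
    by (intro order_trans[OF abs_triangle_ineq] add_mono)
  moreover have "(g \<eta> - (g (mid i) + g1 (mid i) * (\<eta> - mid i))) + (g (mid i) - lam (t - mid i) * \<delta> i)
      = g \<eta> - (lam (t - mid i) * \<delta> i + g1 (mid i) * (\<eta> - mid i))" by simp
  moreover have "C\<^sup>2 * \<tau>\<^sup>2 + C\<^sup>2 * \<tau>\<^sup>2 / 8 = 9/8 * C\<^sup>2 * \<tau>\<^sup>2" by simp
  ultimately show ?thesis by (simp only:)
qed

lemma piece_last:
  "\<bar>integral {real j * \<tau>..t} (\<lambda>\<eta>. g \<eta> * (t - \<eta>) powr (-\<alpha>))
     - \<tau> powr (1 - \<alpha>) / (1 - \<alpha>) * (lam (t - mid j) * a 0 * \<delta> j)\<bar>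
   \<le> \<epsilon> * ((t - real j * \<tau>) powr (1 - \<alpha>) / (1 - \<alpha>))"
proof -
  have tj: "t - real j * \<tau> = \<sigma> * \<tau>" "t - mid j = (\<sigma> - 1/2) * \<tau>" by (simp_all add: t algebra_simps)
  have jt: "real j * \<tau> \<le> t" using tj \<sigma>_bounds \<tau> by (smt (verit) mult_pos_pos)
  have pw: "(\<sigma> * \<tau>) powr (2 - \<alpha>) = \<sigma> * \<tau> * (\<sigma> * \<tau>) powr (1 - \<alpha>)"
    using powr_add[of "\<sigma> * \<tau>" 1 "1 - \<alpha>"] \<sigma>_bounds \<tau> by simp
  have I: "((\<lambda>\<eta>. (t - \<eta>) powr (-\<alpha>)) has_integral (\<sigma> * \<tau>) powr (1 - \<alpha>) / (1 - \<alpha>)) {real j * \<tau>..t}"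
    using kernel_has_integral[OF \<alpha> jt order_refl] by (simp add: tj)
  \<comment> \<open>With this \<open>\<sigma>\<close> both \<open>\<sigma> / (2 - \<alpha>)\<close>
    and \<open>(\<sigma> - 1/2) / (1 - \<alpha>)\<close> equal 1/2, so the two contributions to the
    moment about \<open>mid j\<close> cancel and the unknown slope of the last cell does not
    matter.\<close>
  have "(0 powr (2 - \<alpha>) - (\<sigma> * \<tau>) powr (2 - \<alpha>)) / (2 - \<alpha>)
      + (\<sigma> - 1/2) * \<tau> * (((\<sigma> * \<tau>) powr (1 - \<alpha>) - 0 powr (1 - \<alpha>)) / (1 - \<alpha>)) = 0"
    unfolding pw using \<alpha> by (simp add: \<sigma> field_simps)
  then have J: "((\<lambda>\<eta>. (\<eta> - mid j) * (t - \<eta>) powr (-\<alpha>)) has_integral 0) {real j * \<tau>..t}"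
    using kernel_moment_has_integral[OF \<alpha> jt order_refl, of "mid j"] by (simp add: tj)
  have "\<bar>integral {real j * \<tau>..t} (\<lambda>\<eta>. g \<eta> * (t - \<eta>) powr (-\<alpha>))
     - (lam (t - mid j) * \<delta> j * ((\<sigma> * \<tau>) powr (1 - \<alpha>) / (1 - \<alpha>)) + g1 (mid j) * 0)\<bar>
     \<le> \<epsilon> * ((\<sigma> * \<tau>) powr (1 - \<alpha>) / (1 - \<alpha>))"
  proof (rule integral_kernel_approx[OF \<alpha> jt order_refl _ _ I J])
    show "continuous_on {real j * \<tau>..t} g"
      using \<tau> by (intro continuous_on_subset[OF g_continuous]) auto
    fix \<eta> assume \<eta>: "\<eta> \<in> {real j * \<tau>..t}"
    have "\<sigma> * \<tau> \<le> 1 * \<tau>" using \<sigma>_bounds \<tau> by (intro mult_right_mono) auto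
    moreover have "mid j = real j * \<tau> + \<tau> / 2" "t = real j * \<tau> + \<sigma> * \<tau>" by (simp_all add: t algebra_simps)
    ultimately have "\<bar>\<eta> - mid j\<bar> \<le> \<tau> / 2" using \<eta> unfolding atLeastAtMost_iff by linarith
    moreover have "\<eta> \<in> {0..t}" using \<eta> \<tau> by (auto intro: order_trans[rotated])
    ultimately have "\<bar>g \<eta> - (lam (t - mid j) * \<delta> j + g1 (mid j) * (\<eta> - mid j))\<bar> \<le> 9/8 * C\<^sup>2 * \<tau>\<^sup>2"
      by (intro g_approx_const) auto
    also have "\<dots> \<le> \<epsilon>" by (simp add: \<epsilon>_def)
    finally show "\<bar>g \<eta> - (lam (t - mid j) * \<delta> j + g1 (mid j) * (\<eta> - mid j))\<bar> \<le> \<epsilon>" .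
  qed
  moreover have "(\<sigma> * \<tau>) powr (1 - \<alpha>) = \<tau> powr (1 - \<alpha>) * a 0"
    using \<sigma>_bounds \<tau> by (simp add: powr_mult a_coef_def)
  ultimately show ?thesis unfolding tj(1) by (simp add: mult_ac)
qed

lemma piece:
  assumes "i < j"
  shows "\<bar>integral {real i * \<tau>..real (Suc i) * \<tau>} (\<lambda>\<eta>. g \<eta> * (t - \<eta>) powr (-\<alpha>))
     - \<tau> powr (1 - \<alpha>) / (1 - \<alpha>) * (lam (t - mid i) * a (j - i) * \<delta> i + b (j - i) * slope i)\<bar>
   \<le> \<epsilon> * (((t - real i * \<tau>) powr (1 - \<alpha>) - (t - real (Suc i) * \<tau>) powr (1 - \<alpha>)) / (1 - \<alpha>))"
proof -
  \<comment> \<open>The distance from \<open>t\<close> to the left end of the cell in time steps. As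
    \<open>X > 1\<close>, the singularity lies outside the cell.\<close>
  define X where "X = real (j - i) + \<sigma>"
  have X: "1 < X" using assms \<sigma>_bounds by (auto simp: X_def of_nat_diff)
  have ti: "t - real i * \<tau> = X * \<tau>" "t - real (Suc i) * \<tau> = (X - 1) * \<tau>" "t - mid i = (X - 1/2) * \<tau>"
    using assms by (simp_all add: t X_def of_nat_diff algebra_simps)
  have le: "real i * \<tau> \<le> real (Suc i) * \<tau>" using \<tau> by (simp add: mult_right_mono)
  have le': "real (Suc i) * \<tau> \<le> t" using ti(2) X \<tau> by (smt (verit) mult_pos_pos)
  have 1: "(X * \<tau>) powr r = \<tau> powr r * X powr r" "((X - 1) * \<tau>) powr r = \<tau> powr r * (X - 1) powr r" for r
    using X \<tau> by (simp_all add: powr_mult)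
  have 2: "X powr (2 - \<alpha>) = X * X powr (1 - \<alpha>)" "(X - 1) powr (2 - \<alpha>) = (X - 1) * (X - 1) powr (1 - \<alpha>)"
      "\<tau> powr (2 - \<alpha>) = \<tau> * \<tau> powr (1 - \<alpha>)"
    using powr_add[of X 1 "1 - \<alpha>"] powr_add[of "X - 1" 1 "1 - \<alpha>"] powr_add[of \<tau> 1 "1 - \<alpha>"] X \<tau> by simp_all
  have a: "a (j - i) = X powr (1 - \<alpha>) - (X - 1) powr (1 - \<alpha>)"
    using assms by (simp add: a_coef_def X_def algebra_simps)
  have b: "b (j - i) = (X * X powr (1 - \<alpha>) - (X - 1) * (X - 1) powr (1 - \<alpha>)) / (2 - \<alpha>)
      - (X powr (1 - \<alpha>) + (X - 1) powr (1 - \<alpha>)) / 2"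
  proof -
    have "real (j - i) - 1 + \<sigma> = X - 1" "real (j - i) + \<sigma> = X" by (simp_all add: X_def)
    then show ?thesis unfolding b_coef_def by (simp only: 2) simp
  qed
  have I: "((\<lambda>\<eta>. (t - \<eta>) powr (-\<alpha>)) has_integral \<tau> powr (1 - \<alpha>) / (1 - \<alpha>) * a (j - i)) {real i * \<tau>..real (Suc i) * \<tau>}"
    using kernel_has_integral[OF \<alpha> le le'] unfolding ti 1 a
    by (simp add: right_diff_distrib diff_divide_distrib)
  \<comment> \<open>This is the origin of \<open>b\<close>: up to the scaling factor it is the first
    moment of the kernel about the midpoint of the cell.\<close>
  have "\<tau> * (\<tau> powr (1 - \<alpha>) / (1 - \<alpha>) * b (j - i))
     = (\<tau> powr (2 - \<alpha>) * (X - 1) powr (2 - \<alpha>) - \<tau> powr (2 - \<alpha>) * X powr (2 - \<alpha>)) / (2 - \<alpha>)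
     + (X - 1/2) * \<tau> * ((\<tau> powr (1 - \<alpha>) * X powr (1 - \<alpha>) - \<tau> powr (1 - \<alpha>) * (X - 1) powr (1 - \<alpha>)) / (1 - \<alpha>))"
    unfolding 2 b using \<alpha> by (simp add: divide_simps) (simp add: algebra_simps)
  then have J: "((\<lambda>\<eta>. (\<eta> - mid i) * (t - \<eta>) powr (-\<alpha>)) has_integral
      \<tau> * (\<tau> powr (1 - \<alpha>) / (1 - \<alpha>) * b (j - i))) {real i * \<tau>..real (Suc i) * \<tau>}"
    using kernel_moment_has_integral[OF \<alpha> le le', of "mid i"] unfolding ti 1 by simp
  have "\<bar>integral {real i * \<tau>..real (Suc i) * \<tau>} (\<lambda>\<eta>. g \<eta> * (t - \<eta>) powr (-\<alpha>))
     - (lam (t - mid i) * \<delta> i * (\<tau> powr (1 - \<alpha>) / (1 - \<alpha>) * a (j - i))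
        + slope i / \<tau> * (\<tau> * (\<tau> powr (1 - \<alpha>) / (1 - \<alpha>) * b (j - i))))\<bar>
     \<le> \<epsilon> * (\<tau> powr (1 - \<alpha>) / (1 - \<alpha>) * a (j - i))"
  proof (rule integral_kernel_approx[OF \<alpha> le le' _ _ I J])
    have sub: "{real i * \<tau>..real (Suc i) * \<tau>} \<subseteq> {0..t}"
      using le' \<tau> by auto
    then show "continuous_on {real i * \<tau>..real (Suc i) * \<tau>} g"
      by (rule continuous_on_subset[OF g_continuous])
    fix \<eta> assume \<eta>: "\<eta> \<in> {real i * \<tau>..real (Suc i) * \<tau>}"
    moreover have ms: "mid i = real i * \<tau> + \<tau> / 2" "real (Suc i) * \<tau> = real i * \<tau> + \<tau>"
      by (simp_all add: algebra_simps)
    ultimately have h: "\<bar>\<eta> - mid i\<bar> \<le> \<tau> / 2"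
      unfolding ms(1) by (simp only: ms(2) atLeastAtMost_iff) linarith
    have 1: "\<bar>g \<eta> - (lam (t - mid i) * \<delta> i + g1 (mid i) * (\<eta> - mid i))\<bar> \<le> 9/8 * C\<^sup>2 * \<tau>\<^sup>2"
      using assms h subsetD[OF sub \<eta>] by (intro g_approx_const) auto
    have "\<bar>(slope i - \<tau> * g1 (mid i)) * ((\<eta> - mid i) / \<tau>)\<bar> \<le> (11/4 * C\<^sup>2 * \<tau>\<^sup>2) * (1/2)"
      using slope_bound[OF assms] h \<tau> by (intro abs_mult_le) (auto simp: abs_divide divide_le_eq)
    moreover have "(slope i - \<tau> * g1 (mid i)) * ((\<eta> - mid i) / \<tau>)
       = slope i / \<tau> * (\<eta> - mid i) - g1 (mid i) * (\<eta> - mid i)"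
      using \<tau> by (simp add: field_simps)
    ultimately have 2: "\<bar>slope i / \<tau> * (\<eta> - mid i) - g1 (mid i) * (\<eta> - mid i)\<bar> \<le> (11/4 * C\<^sup>2 * \<tau>\<^sup>2) * (1/2)"
      by (simp only:)
    show "\<bar>g \<eta> - (lam (t - mid i) * \<delta> i + slope i / \<tau> * (\<eta> - mid i))\<bar> \<le> \<epsilon>"
    proof -
      have "g \<eta> - (lam (t - mid i) * \<delta> i + slope i / \<tau> * (\<eta> - mid i))
          = (g \<eta> - (lam (t - mid i) * \<delta> i + g1 (mid i) * (\<eta> - mid i)))
            - (slope i / \<tau> * (\<eta> - mid i) - g1 (mid i) * (\<eta> - mid i))" by simp
      also have "\<bar>\<dots>\<bar> \<le> 9/8 * C\<^sup>2 * \<tau>\<^sup>2 + (11/4 * C\<^sup>2 * \<tau>\<^sup>2) * (1/2)"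
        using add_mono[OF 1 2] by (rule order_trans[OF abs_triangle_ineq4])
      also have "\<dots> = \<epsilon>" by (simp add: \<epsilon>_def)
      finally show ?thesis .
    qed
  qed
  moreover have "((X * \<tau>) powr (1 - \<alpha>) - ((X - 1) * \<tau>) powr (1 - \<alpha>)) / (1 - \<alpha>) = \<tau> powr (1 - \<alpha>) / (1 - \<alpha>) * a (j - i)"
    unfolding 1 a by (simp add: right_diff_distrib diff_divide_distrib)
  moreover have "lam (t - mid i) * \<delta> i * (\<tau> powr (1 - \<alpha>) / (1 - \<alpha>) * a (j - i))
        + slope i / \<tau> * (\<tau> * (\<tau> powr (1 - \<alpha>) / (1 - \<alpha>) * b (j - i)))
     = \<tau> powr (1 - \<alpha>) / (1 - \<alpha>) * (lam (t - mid i) * a (j - i) * \<delta> i + b (j - i) * slope i)"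
    using \<tau> by (simp only: distrib_left) (simp add: mult_ac)
  ultimately show ?thesis by (simp only: ti)
qed

lemma integrable_g: "0 \<le> x \<Longrightarrow> y \<le> t \<Longrightarrow> x \<le> y \<Longrightarrow> (\<lambda>\<eta>. g \<eta> * (t - \<eta>) powr (-\<alpha>)) integrable_on {x..y}"
  by (rule continuous_times_kernel_integrable[OF \<alpha>])
     (auto intro: continuous_on_subset[OF g_continuous])

text \<open>The bound on each cell is \<open>\<epsilon>\<close> times its kernel mass; the masses
  telescope, so no factor counting the cells appears.\<close>

lemma pieces:
  assumes "n \<le> j"
  shows "\<bar>integral {0..real n * \<tau>} (\<lambda>\<eta>. g \<eta> * (t - \<eta>) powr (-\<alpha>))
     - \<tau> powr (1 - \<alpha>) / (1 - \<alpha>) * (\<Sum>i<n. lam (t - mid i) * a (j - i) * \<delta> i + b (j - i) * slope i)\<bar>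
   \<le> \<epsilon> * ((t powr (1 - \<alpha>) - (t - real n * \<tau>) powr (1 - \<alpha>)) / (1 - \<alpha>))"
  using assms
proof (induction n)
  case 0
  then show ?case by simp
next
  case (Suc n)
  let ?K = "\<lambda>\<eta>. g \<eta> * (t - \<eta>) powr (-\<alpha>)"
  have n: "real (Suc n) * \<tau> \<le> t" unfolding t using Suc.prems \<tau> \<sigma>_bounds by (intro mult_right_mono) auto
  have "integral {0..real (Suc n) * \<tau>} ?K = integral {0..real n * \<tau>} ?K + integral {real n * \<tau>..real (Suc n) * \<tau>} ?K"
    using n \<tau> by (intro Henstock_Kurzweil_Integration.integral_combine[symmetric] integrable_g) (auto intro: mult_right_mono)
  moreover note Suc.IH piece[of n]
  moreover have "\<epsilon> * ((t powr (1 - \<alpha>) - (t - real (Suc n) * \<tau>) powr (1 - \<alpha>)) / (1 - \<alpha>))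
     = \<epsilon> * ((t powr (1 - \<alpha>) - (t - real n * \<tau>) powr (1 - \<alpha>)) / (1 - \<alpha>))
     + \<epsilon> * (((t - real n * \<tau>) powr (1 - \<alpha>) - (t - real (Suc n) * \<tau>) powr (1 - \<alpha>)) / (1 - \<alpha>))"
    by (simp only: distrib_left[symmetric] add_divide_distrib[symmetric]) simp
  ultimately show ?case
    using Suc.prems by (simp only: sum.lessThan_Suc distrib_left) linarith
qed

lemma truncation_error:
  "\<bar>1 / Gamma (1 - \<alpha>) * integral {0..t} (\<lambda>\<eta>. lam (t - \<eta>) / (t - \<eta>) powr \<alpha> * v1 \<eta>)
     - discr_caputo \<alpha> \<sigma> lam \<tau> j (\<lambda>s. v (real s * \<tau>))\<bar>
   \<le> 5/2 * C\<^sup>2 * T powr (1 - \<alpha>) / Gamma (2 - \<alpha>) * \<tau>\<^sup>2"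
proof -
  let ?K = "\<lambda>\<eta>. g \<eta> * (t - \<eta>) powr (-\<alpha>)"
  let ?S = "(\<Sum>i<j. lam (t - mid i) * a (j - i) * \<delta> i + b (j - i) * slope i) + lam (t - mid j) * a 0 * \<delta> j"
  have jt: "real j * \<tau> \<le> t" unfolding t using \<tau> \<sigma>_bounds by (intro mult_right_mono) auto
  have G: "Gamma (2 - \<alpha>) = (1 - \<alpha>) * Gamma (1 - \<alpha>)" "0 < Gamma (1 - \<alpha>)"
    using Gamma_plus1[of "1 - \<alpha>"] nonpos_Ints_nonpos[of "1 - \<alpha>"] \<alpha> by (auto intro: Gamma_real_pos)
  have "integral {0..t} ?K = integral {0..real j * \<tau>} ?K + integral {real j * \<tau>..t} ?K"
    using jt \<tau> t_in by (intro Henstock_Kurzweil_Integration.integral_combine[symmetric] integrable_g) auto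
  moreover note pieces[OF order_refl] piece_last
  moreover have "\<epsilon> * ((t powr (1 - \<alpha>) - (t - real j * \<tau>) powr (1 - \<alpha>)) / (1 - \<alpha>))
      + \<epsilon> * ((t - real j * \<tau>) powr (1 - \<alpha>) / (1 - \<alpha>)) = \<epsilon> * (t powr (1 - \<alpha>) / (1 - \<alpha>))"
    by (simp only: distrib_left[symmetric] add_divide_distrib[symmetric]) simp
  ultimately have 1: "\<bar>integral {0..t} ?K - \<tau> powr (1 - \<alpha>) / (1 - \<alpha>) * ?S\<bar> \<le> \<epsilon> * (t powr (1 - \<alpha>) / (1 - \<alpha>))"
    unfolding distrib_left by linarith
  have "t powr (1 - \<alpha>) \<le> T powr (1 - \<alpha>)" using t_in \<alpha> by (intro powr_mono2) auto
  then have "\<epsilon> * (t powr (1 - \<alpha>) / (1 - \<alpha>)) \<le> \<epsilon> * (T powr (1 - \<alpha>) / (1 - \<alpha>))"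
    using \<alpha> by (intro mult_left_mono divide_right_mono) (auto simp: \<epsilon>_def)
  with 1 have "\<bar>integral {0..t} ?K - \<tau> powr (1 - \<alpha>) / (1 - \<alpha>) * ?S\<bar> \<le> \<epsilon> * (T powr (1 - \<alpha>) / (1 - \<alpha>))" by linarith
  then have "1 / Gamma (1 - \<alpha>) * \<bar>integral {0..t} ?K - \<tau> powr (1 - \<alpha>) / (1 - \<alpha>) * ?S\<bar>
      \<le> 1 / Gamma (1 - \<alpha>) * (\<epsilon> * (T powr (1 - \<alpha>) / (1 - \<alpha>)))"
    using G by (intro mult_left_mono) auto
  moreover have "1 / Gamma (1 - \<alpha>) * \<bar>integral {0..t} ?K - \<tau> powr (1 - \<alpha>) / (1 - \<alpha>) * ?S\<bar>
     = \<bar>1 / Gamma (1 - \<alpha>) * integral {0..t} ?K - 1 / Gamma (1 - \<alpha>) * (\<tau> powr (1 - \<alpha>) / (1 - \<alpha>) * ?S)\<bar>"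
    using G(2) by (simp only: right_diff_distrib[symmetric] abs_mult) simp
  moreover have "1 / Gamma (1 - \<alpha>) * (\<tau> powr (1 - \<alpha>) / (1 - \<alpha>) * ?S) = discr_caputo \<alpha> \<sigma> lam \<tau> j (\<lambda>s. v (real s * \<tau>))"
  proof -
    have *: "t - mid i = (real (j - i) + \<sigma> - 1/2) * \<tau>" "t - real (Suc i) * \<tau> = (real (j - i) - 1 + \<sigma>) * \<tau>"
        "t - real i * \<tau> = (real (j - i) + \<sigma>) * \<tau>" if "i \<le> j" for i
      using that by (simp_all add: t of_nat_diff algebra_simps)
    \<comment> \<open>\<open>t - mid i\<close>, \<open>t - real (Suc i) * \<tau>\<close> and
      \<open>t - real i * \<tau>\<close> are exactly the arguments of \<open>lam\<close> in the
      cellwise form of the coefficients.\<close>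
    have "?S = (\<Sum>s\<le>j. c_coef \<alpha> \<sigma> lam \<tau> j (j - s) * \<delta> s)"
      unfolding c_coef_sum
      by (intro arg_cong2[of _ _ _ _ "(+)"] sum.cong refl,
          simp_all only: *(1,2) less_imp_le lessThan_iff order_refl diff_self_eq_0 of_nat_0 add_0)
         (simp only: *(3) less_imp_le lessThan_iff)
    then show ?thesis by (simp add: discr_caputo_def G atMost_atLeast0 mult_ac)
  qed
  moreover have "1 / Gamma (1 - \<alpha>) * (\<epsilon> * (T powr (1 - \<alpha>) / (1 - \<alpha>))) = 5/2 * C\<^sup>2 * T powr (1 - \<alpha>) / Gamma (2 - \<alpha>) * \<tau>\<^sup>2"
    by (simp add: \<epsilon>_def G mult_ac)
  moreover have "?K = (\<lambda>\<eta>. lam (t - \<eta>) / (t - \<eta>) powr \<alpha> * v1 \<eta>)"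
    by (simp add: g_def powr_minus_divide fun_eq_iff)
  ultimately show ?thesis by simp
qed

end
end

section \<open>Consistency in space\<close>

lemma second_diff_le:
  fixes f0 f1 f2 :: "real \<Rightarrow> real"
  assumes "convex S" "\<And>x. x \<in> S \<Longrightarrow> (f0 has_real_derivative f1 x) (at x within S)"
    and "\<And>x. x \<in> S \<Longrightarrow> (f1 has_real_derivative f2 x) (at x within S)"
    and "\<And>x. x \<in> S \<Longrightarrow> \<bar>f2 x\<bar> \<le> B" "x \<in> S" "x + h \<in> S" "x - h \<in> S"
  shows "\<bar>f0 (x + h) - 2 * f0 x + f0 (x - h)\<bar> \<le> 2 * B * h\<^sup>2"
proof -
  have "\<bar>f0 (x + h) - f0 x - f1 x * h\<bar> \<le> B * h\<^sup>2"
    using Taylor_bound_1[OF assms(1-5,6)] .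
  moreover have "\<bar>f0 (x - h) - f0 x + f1 x * h\<bar> \<le> B * h\<^sup>2"
    using Taylor_bound_1[OF assms(1-5), of "- h"] assms by simp
  ultimately show ?thesis by linarith
qed

text \<open>Both expressions have the same expansion \<open>G 2 + h^2 / 12 * G 4\<close> up to order
  four: the weight 1/12 in the compact average is chosen to match the leading error of the second
  difference.\<close>

lemma compact_second_diff_error:
  fixes G :: "nat \<Rightarrow> real \<Rightarrow> real"
  assumes "convex S" "\<And>i x. x \<in> S \<Longrightarrow> i \<le> 5 \<Longrightarrow> (G i has_real_derivative G (Suc i) x) (at x within S)"
    and B: "\<And>x. x \<in> S \<Longrightarrow> \<bar>G 6 x\<bar> \<le> B" and x: "x \<in> S" "x + h \<in> S" "x - h \<in> S" and h: "0 < h"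
  shows "\<bar>(G 2 x + (G 2 (x + h) - 2 * G 2 x + G 2 (x - h)) / 12)
     - (G 0 (x + h) - 2 * G 0 x + G 0 (x - h)) / h\<^sup>2\<bar> \<le> B * h ^ 4"
proof -
  have f: "fact 5 = (120 :: real)" "fact 4 = (24 :: real)" "fact 3 = (6 :: real)"
    by (simp_all add: fact_numeral)
  note T0 = Taylor_bounds[of S 5 G, OF assms(1) assms(2), of B x]
  note T2 = Taylor_bounds[of S 3 "\<lambda>i. G (i + 2)", OF assms(1), of B x]
  have 0: "\<bar>G 0 (x + h) - (G 0 x + G 1 x * h + G 2 x * h\<^sup>2 / 2 + G 3 x * h ^ 3 / 6 + G 4 x * h ^ 4 / 24 + G 5 x * h ^ 5 / 120)\<bar> \<le> B * h ^ 6 / 120"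
    using T0[of h] B x h by (simp add: f eval_nat_numeral algebra_simps)
  have 1: "\<bar>G 0 (x - h) - (G 0 x - G 1 x * h + G 2 x * h\<^sup>2 / 2 - G 3 x * h ^ 3 / 6 + G 4 x * h ^ 4 / 24 - G 5 x * h ^ 5 / 120)\<bar> \<le> B * h ^ 6 / 120"
    using T0[of "- h"] B x h by (simp add: f eval_nat_numeral algebra_simps)
  have 2: "\<bar>G 2 (x + h) - (G 2 x + G 3 x * h + G 4 x * h\<^sup>2 / 2 + G 5 x * h ^ 3 / 6)\<bar> \<le> B * h ^ 4 / 6"
    using T2[of h] assms(2) B x h by (simp add: f eval_nat_numeral algebra_simps)
  have 3: "\<bar>G 2 (x - h) - (G 2 x - G 3 x * h + G 4 x * h\<^sup>2 / 2 - G 5 x * h ^ 3 / 6)\<bar> \<le> B * h ^ 4 / 6"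
    using T2[of "- h"] assms(2) B x h by (simp add: f eval_nat_numeral algebra_simps)
  have "\<bar>G 0 (x + h) - 2 * G 0 x + G 0 (x - h) - (G 2 x * h\<^sup>2 + G 4 x * h ^ 4 / 12)\<bar> \<le> B * h ^ 6 / 60"
    using 0 1 by linarith
  then have "\<bar>(G 0 (x + h) - 2 * G 0 x + G 0 (x - h) - (G 2 x * h\<^sup>2 + G 4 x * h ^ 4 / 12)) / h\<^sup>2\<bar> \<le> B * h ^ 6 / 60 / h\<^sup>2"
    unfolding abs_divide abs_power2 by (rule divide_right_mono) simp
  also have "B * h ^ 6 / 60 / h\<^sup>2 = B * h ^ 4 / 60"
    using h by (simp add: field_simps eval_nat_numeral)
  also have "(G 0 (x + h) - 2 * G 0 x + G 0 (x - h) - (G 2 x * h\<^sup>2 + G 4 x * h ^ 4 / 12)) / h\<^sup>2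
      = (G 0 (x + h) - 2 * G 0 x + G 0 (x - h)) / h\<^sup>2 - (G 2 x + G 4 x * h\<^sup>2 / 12)"
    using h by (simp add: diff_divide_distrib add_divide_distrib eval_nat_numeral)
  finally have 4: "\<bar>(G 0 (x + h) - 2 * G 0 x + G 0 (x - h)) / h\<^sup>2 - (G 2 x + G 4 x * h\<^sup>2 / 12)\<bar> \<le> B * h ^ 4 / 60" .
  have "0 \<le> B * h ^ 4" using B[OF x(1)] h by (intro mult_nonneg_nonneg) auto
  then have b: "0 \<le> B * h ^ 4" .
  \<comment> \<open>Abstracting the Taylor terms makes the combination linear: the odd terms
    \<open>a\<close> and \<open>d\<close> cancel by symmetry, and \<open>1/36 + 1/60\<close> of
    \<open>b\<close> remains as error.\<close>
  have "\<bar>g + (p - 2 * g + m) / 12 - Q\<bar> \<le> b"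
    if "\<bar>p - (g + a + c / 2 + d)\<bar> \<le> b / 6" "\<bar>m - (g - a + c / 2 - d)\<bar> \<le> b / 6"
      "\<bar>Q - (g + c / 12)\<bar> \<le> b / 60" "0 \<le> b" for g p m Q a b c d :: real
    using that unfolding abs_le_iff by (simp add: field_simps)
  from this[OF 2 3 4 b] show ?thesis .
qed

text \<open>Expansion about the intermediate point \<open>r + \<sigma> * \<tau>\<close>: the weights
  of the average cancel the first-order terms for every \<open>\<sigma>\<close> in [0, 1].\<close>

lemma sigma_avg_error:
  fixes f0 f1 f2 :: "real \<Rightarrow> real"
  assumes "convex S" "\<And>x. x \<in> S \<Longrightarrow> (f0 has_real_derivative f1 x) (at x within S)"
    and "\<And>x. x \<in> S \<Longrightarrow> (f1 has_real_derivative f2 x) (at x within S)"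
    and B: "\<And>x. x \<in> S \<Longrightarrow> \<bar>f2 x\<bar> \<le> B"
    and t: "r + \<sigma> * \<tau> \<in> S" "r \<in> S" "r + \<tau> \<in> S" and \<sigma>: "0 \<le> \<sigma>" "\<sigma> \<le> 1"
  shows "\<bar>f0 (r + \<sigma> * \<tau>) - (\<sigma> * f0 (r + \<tau>) + (1 - \<sigma>) * f0 r)\<bar> \<le> B * \<tau>\<^sup>2"
proof -
  let ?t = "r + \<sigma> * \<tau>"
  have B0: "0 \<le> B" using B[OF t(1)] by simp
  have 1: "\<bar>f0 (r + \<tau>) - f0 ?t - f1 ?t * ((1 - \<sigma>) * \<tau>)\<bar> \<le> B * \<tau>\<^sup>2"
  proof -
    have e: "?t + (1 - \<sigma>) * \<tau> = r + \<tau>" by (simp add: algebra_simps)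
    have "\<bar>f0 (r + \<tau>) - f0 ?t - f1 ?t * ((1 - \<sigma>) * \<tau>)\<bar> \<le> B * ((1 - \<sigma>) * \<tau>)\<^sup>2"
      using Taylor_bound_1[OF assms(1-4) t(1), of "(1 - \<sigma>) * \<tau>"] t unfolding e by simp
    also have "((1 - \<sigma>) * \<tau>)\<^sup>2 \<le> 1 * \<tau>\<^sup>2"
      unfolding power_mult_distrib using \<sigma> by (intro mult_right_mono) (auto simp: power_le_one)
    finally show ?thesis using B0 by (simp add: mult_left_mono)
  qed
  have 2: "\<bar>f0 r - f0 ?t + f1 ?t * (\<sigma> * \<tau>)\<bar> \<le> B * \<tau>\<^sup>2"
  proof -
    have "\<bar>f0 r - f0 ?t + f1 ?t * (\<sigma> * \<tau>)\<bar> \<le> B * (\<sigma> * \<tau>)\<^sup>2"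
      using Taylor_bound_1[OF assms(1-4) t(1), of "- (\<sigma> * \<tau>)"] t by simp
    also have "(\<sigma> * \<tau>)\<^sup>2 \<le> 1 * \<tau>\<^sup>2"
      unfolding power_mult_distrib using \<sigma> by (intro mult_right_mono) (auto simp: power_le_one)
    finally show ?thesis using B0 by (simp add: mult_left_mono)
  qed
  have "f0 ?t - (\<sigma> * f0 (r + \<tau>) + (1 - \<sigma>) * f0 r)
     = - (\<sigma> * (f0 (r + \<tau>) - f0 ?t - f1 ?t * ((1 - \<sigma>) * \<tau>)) + (1 - \<sigma>) * (f0 r - f0 ?t + f1 ?t * (\<sigma> * \<tau>)))"
    by (simp add: algebra_simps)
  also have "\<bar>\<dots>\<bar> \<le> \<sigma> * (B * \<tau>\<^sup>2) + (1 - \<sigma>) * (B * \<tau>\<^sup>2)"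
    unfolding abs_minus_cancel using \<sigma> 1 2
    by (intro order_trans[OF abs_triangle_ineq] add_mono) (auto simp: abs_mult intro!: mult_left_mono)
  finally show ?thesis by (simp add: algebra_simps)
qed

section \<open>Testing the error equation\<close>

lemma sum_mult_le_L2_set:
  "(\<Sum>i\<in>I. f i * g i) \<le> L2_set f I * L2_set g I" for f g :: "'i \<Rightarrow> real"
proof -
  have "(\<Sum>i\<in>I. f i * g i) \<le> (\<Sum>i\<in>I. \<bar>f i\<bar> * \<bar>g i\<bar>)"
    by (intro sum_mono) (simp flip: abs_mult)
  then show ?thesis using L2_set_mult_ineq[of f g I] by linarith
qed

lemma L2_set_le_const:
  assumes "\<And>i. i \<in> I \<Longrightarrow> \<bar>f i\<bar> \<le> K"
  shows "L2_set f I \<le> sqrt (card I) * \<bar>K\<bar>"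
proof -
  have "L2_set f I = L2_set (\<lambda>i. \<bar>f i\<bar>) I" by (simp add: L2_set_def)
  also have "\<dots> \<le> L2_set (\<lambda>i. K) I" using assms by (intro L2_set_mono) auto
  finally show ?thesis by (simp add: L2_set_constant)
qed

text \<open>The source \<open>d * r\<close> carries the same coefficient as the damping
  \<open>- d * W\<close>, so the threshold for \<open>W\<close> at which damping wins is independent
  of \<open>d\<close>. The factor 2/3 in the bound on \<open>\<psi>\<close> is the one from
  \<open>compact_energy\<close>, giving \<open>\<psi>\<close> that same threshold. The factor
  \<open>sqrt n\<close> appears because \<open>L2_set\<close> has no mesh weight.\<close>

lemma error_equation_dichotomy:
  fixes n :: nat and Z W D \<psi> r :: "nat \<Rightarrow> real"
  assumes Z: "Z 0 = 0" "Z (Suc n) = 0"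
    and W: "\<And>i. i \<in> {1..n} \<Longrightarrow> W i = Z i + diff2 Z i / 12"
    and D: "\<And>i. i \<in> {1..n} \<Longrightarrow> D i = \<kappa> * ((real (Suc n))\<^sup>2 * diff2 Z i) - d * W i + \<psi> i + d * r i"
    and c: "0 < c" "c \<le> \<kappa>" "0 \<le> d"
    and \<psi>: "\<And>i. i \<in> {1..n} \<Longrightarrow> \<bar>\<psi> i\<bar> \<le> 2/3 * c * R"
    and r: "\<And>i. i \<in> {1..n} \<Longrightarrow> \<bar>r i\<bar> \<le> R" and R: "0 \<le> R"
  shows "L2_set W {1..n} \<le> sqrt n * R \<or> (\<Sum>i=1..n. W i * D i) \<le> 0"
proof (cases "L2_set W {1..n} \<le> sqrt n * R")
  case False
  let ?W = "L2_set W {1..n}"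
  have W2: "?W\<^sup>2 = (\<Sum>i=1..n. (Z i + diff2 Z i / 12)\<^sup>2)"
    using W by (simp add: L2_set_def sum_nonneg)
  have "(\<Sum>i=1..n. W i * D i) = (\<Sum>i=1..n. \<kappa> * ((Z i + diff2 Z i / 12) * ((real (Suc n))\<^sup>2 * diff2 Z i))
      - d * (Z i + diff2 Z i / 12)\<^sup>2 + W i * \<psi> i + d * (W i * r i))"
    using W D by (intro sum.cong refl) (simp only: power2_eq_square distrib_left right_diff_distrib mult_ac)
  also have "\<dots> = \<kappa> * (\<Sum>i=1..n. (Z i + diff2 Z i / 12) * ((real (Suc n))\<^sup>2 * diff2 Z i))
      - d * ?W\<^sup>2 + (\<Sum>i=1..n. W i * \<psi> i) + d * (\<Sum>i=1..n. W i * r i)"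
    unfolding W2 by (simp only: sum.distrib sum_subtractf sum_distrib_left)
  also have "\<dots> \<le> \<kappa> * (- (2/3) * ?W\<^sup>2) - d * ?W\<^sup>2 + ?W * (sqrt n * (2/3 * c * R)) + d * (?W * (sqrt n * R))"
  proof (intro add_mono diff_mono order_refl mult_left_mono)
    show "(\<Sum>i=1..n. (Z i + diff2 Z i / 12) * ((real (Suc n))\<^sup>2 * diff2 Z i)) \<le> - (2/3) * ?W\<^sup>2"
      using compact_energy[OF Z] compact_sq_le[OF Z] unfolding W2 by linarith
    have "L2_set \<psi> {1..n} \<le> sqrt n * (2/3 * c * R)" "L2_set r {1..n} \<le> sqrt n * R"
      using L2_set_le_const[of "{1..n}", OF \<psi>] L2_set_le_const[of "{1..n}", OF r] c R by simp_all
    note le = this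
    show "(\<Sum>i=1..n. W i * \<psi> i) \<le> ?W * (sqrt n * (2/3 * c * R))"
      by (rule order_trans[OF sum_mult_le_L2_set mult_left_mono[OF le(1) L2_set_nonneg]])
    show "(\<Sum>i=1..n. W i * r i) \<le> ?W * (sqrt n * R)"
      by (rule order_trans[OF sum_mult_le_L2_set mult_left_mono[OF le(2) L2_set_nonneg]])
  qed (use c in auto)
  \<comment> \<open>Only the part \<open>c\<close> of \<open>\<kappa>\<close> is spent on
    \<open>\<psi>\<close>; the surplus \<open>\<kappa> - c\<close> contributes with a favourable
    sign.\<close>
  also have "\<dots> = - (2/3 * (\<kappa> - c) * ?W\<^sup>2) - (2/3 * c + d) * (?W * (?W - sqrt n * R))"
    by (simp add: power2_eq_square field_simps)
  also have "\<dots> \<le> 0"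
  proof -
    have "0 \<le> 2/3 * (\<kappa> - c) * ?W\<^sup>2" "0 \<le> (2/3 * c + d) * (?W * (?W - sqrt n * R))"
      using c False by (auto intro!: mult_nonneg_nonneg)
    then show ?thesis by linarith
  qed
  finally show ?thesis ..
qed simp

section \<open>Convergence\<close>

lemma deriv_on_works:
  assumes "g differentiable_on S" "x \<in> S"
  shows "(g has_real_derivative deriv_on S g x) (at x within S)"
  using assms vector_derivative_works[of g "at x within S"]
  by (simp add: deriv_on_def differentiable_on_def has_real_derivative_iff_has_vector_derivative)

lemma C_class_deriv:
  assumes "C_class n S g" "m < n" "x \<in> S"
  shows "((deriv_on S ^^ m) g has_real_derivative (deriv_on S ^^ Suc m) g x) (at x within S)"
  using assms deriv_on_works[of "(deriv_on S ^^ m) g" S x] by (simp add: C_class_def)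

lemma C_class_bounded:
  assumes "C_class n S g" "compact S"
  shows "\<exists>C. \<forall>m\<le>n. \<forall>x\<in>S. \<bar>(deriv_on S ^^ m) g x\<bar> \<le> C"
proof -
  have "bounded (\<Union>m\<in>{..n}. (deriv_on S ^^ m) g ` S)"
    using assms by (intro bounded_UN compact_imp_bounded compact_continuous_image ballI) (auto simp: C_class_def)
  then show ?thesis by (auto simp: bounded_iff)
qed

lemma C_xt_class_bounded:
  assumes "C_xt_class T p q u"
  shows "\<exists>C. \<forall>r\<le>p. \<forall>s\<le>q. \<forall>x\<in>{0..1}. \<forall>t\<in>{0..T}. \<bar>partial_xt T r s u x t\<bar> \<le> C"
proof -
  have "bounded (\<Union>(r, s)\<in>{..p} \<times> {..q}. (\<lambda>(x, t). partial_xt T r s u x t) ` ({0..1} \<times> {0..T}))"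
    using assms
    by (intro bounded_UN ballI) (auto simp: C_xt_class_def intro!: compact_imp_bounded compact_continuous_image compact_Times)
  then obtain C where "\<forall>v\<in>(\<Union>(r, s)\<in>{..p} \<times> {..q}. (\<lambda>(x, t). partial_xt T r s u x t) ` ({0..1} \<times> {0..T})). \<bar>v\<bar> \<le> C"
    by (auto simp: bounded_iff)
  then show ?thesis by (intro exI[of _ C]) force
qed

lemma C_xt_class_deriv_t:
  assumes "C_xt_class T p q u" "s < q" "x \<in> {0..1}" "t \<in> {0..T}"
  shows "(partial_xt T 0 s u x has_real_derivative partial_xt T 0 (Suc s) u x t) (at t within {0..T})"
proof -
  have "(deriv_on {0..T} ^^ s) (u x) differentiable_on {0..T}"
    using assms by (auto simp: C_xt_class_def partial_xt_def)
  from deriv_on_works[OF this assms(4)] show ?thesis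
    by (simp add: partial_xt_def[abs_def])
qed

lemma C_xt_class_deriv_x:
  assumes "C_xt_class T p q u" "r < p" "s \<le> q" "x \<in> {0..1}" "t \<in> {0..T}"
  shows "((\<lambda>x. partial_xt T r s u x t) has_real_derivative partial_xt T (Suc r) s u x t) (at x within {0..1})"
proof -
  have "(\<lambda>x. partial_xt T r s u x t) differentiable_on {0..1}"
    using assms by (auto simp: C_xt_class_def)
  from deriv_on_works[OF this assms(4)] show ?thesis
    by (simp add: partial_xt_def)
qed

lemma partial_xt_0_0: "partial_xt T 0 0 u x t = u x t"
  by (simp add: partial_xt_def)

lemma compact_avg_eq: "0 < h \<Longrightarrow> compact_avg h v i = v i + diff2 v i / 12"
  by (simp add: compact_avg_def second_diff_def)

lemma compact_avg_linear:
  "compact_avg h (\<lambda>m. a * v m + b * w m) i = a * compact_avg h v i + b * compact_avg h w i"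
proof -
  \<comment> \<open>Equal to 1/12 for nonzero \<open>h\<close> and to 0 for \<open>h = 0\<close>, so
    linearity holds for every \<open>h\<close>.\<close>
  define c where "c = h\<^sup>2 / 12 / h\<^sup>2"
  have c: "compact_avg h v i = v i + c * diff2 v i" for v
    by (simp add: compact_avg_def second_diff_def c_def)
  show ?thesis unfolding c by (simp add: algebra_simps)
qed

lemma compact_avg_diff: "compact_avg h (\<lambda>m. v m - w m) i = compact_avg h v i - compact_avg h w i"
  using compact_avg_linear[of h 1 v "-1" w] by simp

lemma compact_avg_sum:
  "finite A \<Longrightarrow> compact_avg h (\<lambda>m. \<Sum>s\<in>A. c s * v s m) i = (\<Sum>s\<in>A. c s * compact_avg h (v s) i)"
proof (induction A rule: finite_induct)
  case empty
  then show ?case by (simp add: compact_avg_def second_diff_def)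
next
  case (insert x A)
  then show ?case
    using compact_avg_linear[of h "c x" "v x" 1 "\<lambda>m. \<Sum>s\<in>A. c s * v s m"] by simp
qed

lemma second_diff_diff: "second_diff h (\<lambda>m. v m - w m) i = second_diff h v i - second_diff h w i"
  by (simp add: second_diff_def algebra_simps flip: diff_divide_distrib)

lemma compact_avg_cong:
  assumes "\<And>m. m \<le> Suc i \<Longrightarrow> v m = w m"
  shows "compact_avg h v i = compact_avg h w i"
  using assms by (simp add: compact_avg_def second_diff_def)

text \<open>The compact average is a convex combination with weights 1/12, 10/12, 1/12.\<close>

lemma compact_avg_abs_le:
  assumes "0 < h" "\<And>m. m \<le> Suc i \<Longrightarrow> \<bar>e m\<bar> \<le> K"
  shows "\<bar>compact_avg h e i\<bar> \<le> K"
proof -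
  have e: "compact_avg h e i = (e (Suc i) + 10 * e i + e (i - 1)) / 12"
    using assms(1) by (simp add: compact_avg_eq field_simps)
  have "\<bar>(a + 10 * b + c) / 12\<bar> \<le> K" if "\<bar>a\<bar> \<le> K" "\<bar>b\<bar> \<le> K" "\<bar>c\<bar> \<le> K" for a b c :: real
    using that by (simp add: abs_le_iff)
  from this[of "e (Suc i)" "e i" "e (i - 1)"] show ?thesis unfolding e using assms(2) by simp
qed

lemma compact_avg_discr_caputo:
  "discr_caputo \<alpha> \<sigma> lam \<tau> j (\<lambda>s. compact_avg h (\<lambda>m. y m s) i)
   = compact_avg h (\<lambda>m. discr_caputo \<alpha> \<sigma> lam \<tau> j (y m)) i"
proof -
  define w where "w s = \<tau> powr (1 - \<alpha>) / Gamma (2 - \<alpha>) * c_coef \<alpha> \<sigma> lam \<tau> j (j - s) / \<tau>" for s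
  have D: "discr_caputo \<alpha> \<sigma> lam \<tau> j v = (\<Sum>s=0..j. w s * (v (s + 1) - v s))" for v
    by (simp add: discr_caputo_def w_def sum_distrib_left mult.assoc)
  show ?thesis
    unfolding D by (subst compact_avg_sum) (simp_all add: compact_avg_diff)
qed

lemma sigma_avg_compact_avg:
  "compact_avg h (sigma_avg \<sigma> y j) i
   = \<sigma> * compact_avg h (\<lambda>m. y m (Suc j)) i + (1 - \<sigma>) * compact_avg h (\<lambda>m. y m j) i"
  by (simp add: sigma_avg_def[abs_def] compact_avg_linear)

section \<open>The error of the compact scheme for the diffusion problem\<close>

locale diffusion_problem =
  fixes \<alpha> \<sigma> T c1 c2 :: real
    and lam k q u0 :: "real \<Rightarrow> real"
    and f u :: "real \<Rightarrow> real \<Rightarrow> real"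
  assumes \<alpha>: "0 < \<alpha>" "\<alpha> < 1" and \<sigma>: "\<sigma> = 1 - \<alpha> / 2" and T: "0 < T"
    and lam_C2: "C_class 2 {0..T} lam"
    and lam: "\<forall>t\<in>{0..T}. lam t > 0 \<and> deriv_on {0..T} lam t \<le> 0"
    and c1: "0 < c1"
    and kq: "\<forall>t\<in>{0..T}. c1 \<le> k t \<and> k t \<le> c2 \<and> q t \<ge> 0"
    and f: "continuous_on ({0..1} \<times> {0..T}) (\<lambda>(x, t). f x t)"
    and u: "C_xt_class T 6 3 u"
    and exact: "is_exact_solution \<alpha> lam T k q f u0 u"
begin

lemma lam_antimono: "0 \<le> s \<Longrightarrow> s \<le> t \<Longrightarrow> t \<le> T \<Longrightarrow> lam t \<le> lam s"
proof -
  assume st: "0 \<le> s" "s \<le> t" "t \<le> T"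
  have d: "(lam has_real_derivative deriv_on {0..T} lam x) (at x within {0..T})" if "x \<in> {0..T}" for x
    using C_class_deriv[OF lam_C2, of 0 x] that by simp
  show "lam t \<le> lam s"
  proof (rule DERIV_nonpos_imp_decreasing_open[OF st(2)])
    fix x assume x: "s < x" "x < t"
    then have "(lam has_real_derivative deriv_on {0..T} lam x) (at x)"
      using d[of x] st by (simp add: at_within_Icc_at)
    then show "\<exists>y. (lam has_real_derivative y) (at x) \<and> y \<le> 0"
      using lam x st by (intro exI conjI) auto
  next
    show "continuous_on {s..t} lam"
      using st by (intro continuous_on_subset[OF DERIV_continuous_on[of "{0..T}" lam "deriv_on {0..T} lam"]] d) auto
  qed
qed

sublocale memory_kernel \<alpha> \<sigma> T lam
  using \<alpha> \<sigma> lam lam_antimono by unfold_locales auto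

text \<open>One bound for \<open>lam\<close>, \<open>u\<close> and their derivatives, fixed before
  any grid is introduced, so that the final constant cannot depend on the steps. Compactness
  provides it.\<close>

definition C :: real where
  "C = (SOME C. (\<forall>m\<le>2. \<forall>x\<in>{0..T}. \<bar>(deriv_on {0..T} ^^ m) lam x\<bar> \<le> C) \<and>
     (\<forall>r\<le>6. \<forall>s\<le>3. \<forall>x\<in>{0..1}. \<forall>t\<in>{0..T}. \<bar>partial_xt T r s u x t\<bar> \<le> C))"

lemma C_bounds:
  shows "m \<le> 2 \<Longrightarrow> x \<in> {0..T} \<Longrightarrow> \<bar>(deriv_on {0..T} ^^ m) lam x\<bar> \<le> C"
    and "r \<le> 6 \<Longrightarrow> s \<le> 3 \<Longrightarrow> y \<in> {0..1} \<Longrightarrow> t \<in> {0..T} \<Longrightarrow> \<bar>partial_xt T r s u y t\<bar> \<le> C"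
proof -
  obtain C1 where C1: "\<forall>m\<le>2. \<forall>x\<in>{0..T}. \<bar>(deriv_on {0..T} ^^ m) lam x\<bar> \<le> C1"
    using C_class_bounded[OF lam_C2] by auto
  obtain C2 where C2: "\<forall>r\<le>6. \<forall>s\<le>3. \<forall>x\<in>{0..1}. \<forall>t\<in>{0..T}. \<bar>partial_xt T r s u x t\<bar> \<le> C2"
    using C_xt_class_bounded[OF u] by auto
  have "(\<forall>m\<le>2. \<forall>x\<in>{0..T}. \<bar>(deriv_on {0..T} ^^ m) lam x\<bar> \<le> C) \<and>
     (\<forall>r\<le>6. \<forall>s\<le>3. \<forall>x\<in>{0..1}. \<forall>t\<in>{0..T}. \<bar>partial_xt T r s u x t\<bar> \<le> C)"
    unfolding C_def
    by (rule someI[of _ "max C1 C2"]) (use C1 C2 in \<open>force simp: le_max_iff_disj\<close>)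
  then show "m \<le> 2 \<Longrightarrow> x \<in> {0..T} \<Longrightarrow> \<bar>(deriv_on {0..T} ^^ m) lam x\<bar> \<le> C"
    and "r \<le> 6 \<Longrightarrow> s \<le> 3 \<Longrightarrow> y \<in> {0..1} \<Longrightarrow> t \<in> {0..T} \<Longrightarrow> \<bar>partial_xt T r s u y t\<bar> \<le> C"
    by blast+
qed

lemma C_nonneg: "0 \<le> C"
  using C_bounds(1)[of 0 0] T by fastforce

lemma gen_caputo_eq:
  "gen_caputo \<alpha> lam T u x t = 1 / Gamma (1 - \<alpha>) *
     integral {0..t} (\<lambda>\<eta>. (lam (t - \<eta>) * partial_xt T 0 1 u x \<eta>) * (t - \<eta>) powr (-\<alpha>))"
  unfolding gen_caputo_def powr_minus_divide by (simp add: mult.commute)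

lemma integrand_continuous:
  assumes "0 < t" "t \<le> T" "x \<in> {0..1}"
  shows "continuous_on {0..t} (\<lambda>\<eta>. lam (t - \<eta>) * partial_xt T 0 1 u x \<eta>)"
proof (intro continuous_on_mult)
  have "continuous_on {0..T} lam" using lam_C2 by (auto simp: C_class_def)
  then show "continuous_on {0..t} (\<lambda>\<eta>. lam (t - \<eta>))"
    by (rule continuous_on_compose2) (use assms in \<open>auto intro!: continuous_intros\<close>)
  have "continuous_on {0..T} (partial_xt T 0 1 u x)"
    using C_xt_class_deriv_t[OF u, of 1 x] assms by (intro DERIV_continuous_on) auto
  then show "continuous_on {0..t} (partial_xt T 0 1 u x)"
    by (rule continuous_on_subset) (use assms in auto)
qed

text \<open>Boundedness of the mixed derivative in x and t makes the smooth factor Lipschitz in x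
  uniformly in time, and integration against the integrable kernel preserves this.\<close>

lemma gen_caputo_continuous:
  assumes t: "0 < t" "t \<le> T"
  shows "continuous_on {0..1} (\<lambda>x. gen_caputo \<alpha> lam T u x t)"
proof -
  let ?K = "\<lambda>\<eta>. (t - \<eta>) powr (-\<alpha>)" and ?g = "\<lambda>x \<eta>. lam (t - \<eta>) * partial_xt T 0 1 u x \<eta>"
  define I where "I = t powr (1 - \<alpha>) / (1 - \<alpha>)"
  have I0: "0 \<le> I" using \<alpha> by (simp add: I_def)
  have I: "(?K has_integral I) {0..t}"
    using kernel_has_integral[OF \<alpha>, of 0 t t] t by (simp add: I_def)
  have int: "(\<lambda>\<eta>. ?g x \<eta> * ?K \<eta>) integrable_on {0..t}" if "x \<in> {0..1}" for x
    using t integrand_continuous[OF t that] by (intro continuous_times_kernel_integrable[OF \<alpha>]) auto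
  have "(C * C * I)-lipschitz_on {0..1} (\<lambda>x. integral {0..t} (\<lambda>\<eta>. ?g x \<eta> * ?K \<eta>))"
  proof (rule lipschitz_onI)
    fix x y :: real assume xy: "x \<in> {0..1}" "y \<in> {0..1}"
    \<comment> \<open>Approximation by the zero function (\<open>A = 0\<close>,
      \<open>c = 0\<close>) turns \<open>integral_kernel_approx\<close> into a plain bound on the
      integral.\<close>
    have "\<bar>integral {0..t} (\<lambda>\<eta>. (?g x \<eta> - ?g y \<eta>) * ?K \<eta>) - (0 * I + 0 * integral {0..t} (\<lambda>\<eta>. (\<eta> - 0) * ?K \<eta>))\<bar>
        \<le> (C * (C * \<bar>x - y\<bar>)) * I"
    proof (rule integral_kernel_approx[OF \<alpha> _ order_refl _ _ I])
      show "continuous_on {0..t} (\<lambda>\<eta>. ?g x \<eta> - ?g y \<eta>)"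
        using t xy by (intro continuous_on_diff integrand_continuous) auto
      show "((\<lambda>\<eta>. (\<eta> - 0) * ?K \<eta>) has_integral integral {0..t} (\<lambda>\<eta>. (\<eta> - 0) * ?K \<eta>)) {0..t}"
        using t by (intro integrable_integral continuous_times_kernel_integrable[OF \<alpha>] continuous_intros) auto
      fix \<eta> assume \<eta>: "\<eta> \<in> {0..t}"
      have "\<bar>partial_xt T 0 1 u (y + (x - y)) \<eta> - partial_xt T 0 1 u y \<eta>\<bar> \<le> C * \<bar>x - y\<bar>"
        using xy \<eta> t C_xt_class_deriv_x[OF u, of 0 1] C_bounds(2)[of 1 1]
        by (intro Taylor_bound_0[of "{0..1}" "\<lambda>x. partial_xt T 0 1 u x \<eta>" "\<lambda>x. partial_xt T 1 1 u x \<eta>"]) auto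
      moreover have "\<bar>lam (t - \<eta>)\<bar> \<le> C" using C_bounds(1)[of 0 "t - \<eta>"] \<eta> t by simp
      ultimately have "\<bar>lam (t - \<eta>) * (partial_xt T 0 1 u x \<eta> - partial_xt T 0 1 u y \<eta>)\<bar> \<le> C * (C * \<bar>x - y\<bar>)"
        using C_nonneg by (simp add: abs_mult mult_mono')
      then show "\<bar>?g x \<eta> - ?g y \<eta> - (0 + 0 * (\<eta> - 0))\<bar> \<le> C * (C * \<bar>x - y\<bar>)"
        by (simp add: right_diff_distrib)
    qed (use t in auto)
    moreover have "integral {0..t} (\<lambda>\<eta>. (?g x \<eta> - ?g y \<eta>) * ?K \<eta>)
       = integral {0..t} (\<lambda>\<eta>. ?g x \<eta> * ?K \<eta>) - integral {0..t} (\<lambda>\<eta>. ?g y \<eta> * ?K \<eta>)"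
      unfolding left_diff_distrib using int xy by (intro Henstock_Kurzweil_Integration.integral_diff) auto
    ultimately show "dist (integral {0..t} (\<lambda>\<eta>. ?g x \<eta> * ?K \<eta>)) (integral {0..t} (\<lambda>\<eta>. ?g y \<eta> * ?K \<eta>))
        \<le> (C * C * I) * dist x y"
      by (simp add: dist_real_def mult_ac)
  qed (use I0 in auto)
  then show ?thesis
    unfolding gen_caputo_eq by (intro continuous_on_mult_left lipschitz_on_continuous_on)
qed

text \<open>The scheme evaluates \<open>f\<close> at the boundary nodes as well, where the differential equation is only
  available as a limit.\<close>

lemma equation_closed:
  assumes t: "0 < t" "t \<le> T" and x: "x \<in> {0..1}"
  shows "f x t = gen_caputo \<alpha> lam T u x t - k t * partial_xt T 2 0 u x t + q t * u x t"
proof -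
  define E where "E x = f x t - (gen_caputo \<alpha> lam T u x t - k t * partial_xt T 2 0 u x t + q t * partial_xt T 0 0 u x t)" for x
  have slice: "continuous_on {0..1} (\<lambda>x. F x t)"
    if "continuous_on ({0..1} \<times> {0..T}) (\<lambda>(x, t). F x t)" for F :: "real \<Rightarrow> real \<Rightarrow> real"
  proof -
    have "continuous_on {0..1} (\<lambda>x. (x, t))" by (intro continuous_intros)
    moreover have "(\<lambda>x. (x, t)) ` {0..1} \<subseteq> {0..1} \<times> {0..T}" using t by auto
    ultimately show ?thesis using continuous_on_compose2[of "{0..1} \<times> {0..T}" "\<lambda>(x, t). F x t" "{0..1}" "\<lambda>x. (x, t)"] that by simp
  qed
  have p: "continuous_on {0..1} (\<lambda>x. partial_xt T r 0 u x t)" if "r \<le> 6" for r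
    using u that by (intro slice[of "partial_xt T r 0 u"]) (auto simp: C_xt_class_def)
  have "continuous_on {0..1} (\<lambda>x. f x t)"
    by (rule slice[of f, OF f])
  then have "continuous_on {0..1} E"
    unfolding E_def using p gen_caputo_continuous[OF t]
    by (intro continuous_on_diff continuous_on_add continuous_on_mult_left) auto
  moreover have "E y = 0" if "y \<in> {0<..<1}" for y
    using exact that t by (simp add: is_exact_solution_def E_def partial_xt_0_0)
  ultimately have "E x = 0"
    using continuous_constant_on_closure[of "{0<..<1}" E 0 x] x by simp
  then show ?thesis by (simp add: E_def partial_xt_0_0)
qed

definition K\<^sub>t :: real where "K\<^sub>t = 5/2 * C\<^sup>2 * T powr (1 - \<alpha>) / Gamma (2 - \<alpha>)"

lemma K\<^sub>t_nonneg: "0 \<le> K\<^sub>t"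
  using \<alpha> by (auto simp: K\<^sub>t_def intro!: divide_nonneg_nonneg less_imp_le[OF Gamma_real_pos])

text \<open>The one-variable estimate is used with x frozen; as \<open>C\<close> bounds the
  derivatives at all x, the constant is uniform in space.\<close>

lemma time_truncation:
  assumes "x \<in> {0..1}" "0 < \<tau>" "(real j + 1) * \<tau> \<le> T"
  shows "\<bar>gen_caputo \<alpha> lam T u x ((real j + \<sigma>) * \<tau>) - discr_caputo \<alpha> \<sigma> lam \<tau> j (\<lambda>s. u x (real s * \<tau>))\<bar> \<le> K\<^sub>t * \<tau>\<^sup>2"
proof -
  have 3: "Suc 2 = 3" by simp
  interpret caputo_truncation \<alpha> \<sigma> T lam "deriv_on {0..T} lam" "(deriv_on {0..T} ^^ 2) lam"
      "u x" "partial_xt T 0 1 u x" "partial_xt T 0 2 u x" "partial_xt T 0 3 u x" C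
  proof
    show "\<And>s. s \<in> {0..T} \<Longrightarrow> (lam has_real_derivative deriv_on {0..T} lam s) (at s within {0..T})"
      using C_class_deriv[OF lam_C2, of 0] by simp
    show "\<And>s. s \<in> {0..T} \<Longrightarrow> (deriv_on {0..T} lam has_real_derivative (deriv_on {0..T} ^^ 2) lam s) (at s within {0..T})"
      using C_class_deriv[OF lam_C2, of 1] by (simp add: numeral_2_eq_2)
    show "\<And>s. s \<in> {0..T} \<Longrightarrow> (u x has_real_derivative partial_xt T 0 1 u x s) (at s within {0..T})"
      using C_xt_class_deriv_t[OF u, of 0 x] assms by (simp add: partial_xt_0_0[abs_def])
    show "\<And>s. s \<in> {0..T} \<Longrightarrow> (partial_xt T 0 1 u x has_real_derivative partial_xt T 0 2 u x s) (at s within {0..T})"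
      using C_xt_class_deriv_t[OF u, of 1 x] assms by (simp add: numeral_2_eq_2)
    show "\<And>s. s \<in> {0..T} \<Longrightarrow> (partial_xt T 0 2 u x has_real_derivative partial_xt T 0 3 u x s) (at s within {0..T})"
      using C_xt_class_deriv_t[OF u, of 2 x] assms by (simp add: 3)
    fix s assume s: "s \<in> {0..T}"
    show "\<bar>lam s\<bar> \<le> C" "\<bar>deriv_on {0..T} lam s\<bar> \<le> C" "\<bar>(deriv_on {0..T} ^^ 2) lam s\<bar> \<le> C"
      using C_bounds(1)[OF _ s, of 0] C_bounds(1)[OF _ s, of 1] C_bounds(1)[OF _ s, of 2] by simp_all
    show "\<bar>partial_xt T 0 1 u x s\<bar> \<le> C" "\<bar>partial_xt T 0 2 u x s\<bar> \<le> C" "\<bar>partial_xt T 0 3 u x s\<bar> \<le> C"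
      using assms s by (auto intro!: C_bounds(2))
  qed
  show ?thesis
    using truncation_error[OF assms(2,3) refl] by (simp add: gen_caputo_def K\<^sub>t_def)
qed

context
  fixes n M :: nat and y :: "nat \<Rightarrow> nat \<Rightarrow> real" and h \<tau> :: real
  assumes M: "1 \<le> M" and h_def: "h = 1 / real (Suc n)" and \<tau>_def: "\<tau> = T / real M"
    and y: "is_scheme_solution \<alpha> \<sigma> lam T k q f u0 (Suc n) M y"
begin

lemma steps_pos: "0 < h" "0 < \<tau>"
  using T M by (auto simp: h_def \<tau>_def)

lemma x_in: "m \<le> Suc n \<Longrightarrow> real m * h \<in> {0..1}"
  by (simp add: h_def)

lemma t_in: "j \<le> M \<Longrightarrow> real j * \<tau> \<in> {0..T}"
  using T M by (simp add: \<tau>_def field_simps)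

definition z where "z m s = u (real m * h) (real s * \<tau>) - y m s"
text \<open>The time index comes first, so that \<open>V s\<close> is a vector over the space nodes
  as in \<open>level_bound_step\<close>.\<close>

definition V where "V s i = compact_avg h (\<lambda>m. z m s) i"

lemma y_boundary: "j \<le> M \<Longrightarrow> y 0 j = 0" "j \<le> M \<Longrightarrow> y (Suc n) j = 0"
    and y_initial: "m \<le> Suc n \<Longrightarrow> y m 0 = u0 (real m * h)"
  using y by (auto simp: is_scheme_solution_def Let_def h_def)

lemma u_boundary: "t \<in> {0..T} \<Longrightarrow> u 0 t = 0" "t \<in> {0..T} \<Longrightarrow> u 1 t = 0"
    and u_initial: "x \<in> {0..1} \<Longrightarrow> u x 0 = u0 x"
  using exact by (auto simp: is_exact_solution_def)

lemma z_0: "j \<le> M \<Longrightarrow> z 0 j = 0" "j \<le> M \<Longrightarrow> z (Suc n) j = 0"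
proof -
  have "real (Suc n) * h = 1" by (simp add: h_def)
  then show "j \<le> M \<Longrightarrow> z 0 j = 0" "j \<le> M \<Longrightarrow> z (Suc n) j = 0"
    by (simp_all only: z_def y_boundary u_boundary t_in of_nat_0 mult_zero_left diff_self)
qed

lemma V_0: assumes "i \<in> {1..n}" shows "V 0 i = 0"
proof -
  have "V 0 i = compact_avg h (\<lambda>_. 0) i"
    unfolding V_def
  proof (rule compact_avg_cong)
    fix m assume "m \<le> Suc i"
    then have "m \<le> Suc n" using assms by simp
    then show "z m 0 = 0"
      by (simp only: z_def y_initial u_initial x_in of_nat_0 mult_zero_left diff_self)
  qed
  then show ?thesis by (simp add: compact_avg_def second_diff_def)
qed

text \<open>The consistency errors without a factor \<open>q\<close>. The second summand compares
  the average of the second space derivative at the intermediate time with the second difference of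
  the weighted levels, and so contains both a spatial and a temporal error.\<close>

definition \<psi> where
  "\<psi> j i = compact_avg h (\<lambda>m. discr_caputo \<alpha> \<sigma> lam \<tau> j (\<lambda>s. u (real m * h) (real s * \<tau>))
              - gen_caputo \<alpha> lam T u (real m * h) ((real j + \<sigma>) * \<tau>)) i
     + k ((real j + \<sigma>) * \<tau>) * (compact_avg h (\<lambda>m. partial_xt T 2 0 u (real m * h) ((real j + \<sigma>) * \<tau>)) i
         - second_diff h (sigma_avg \<sigma> (\<lambda>m s. u (real m * h) (real s * \<tau>)) j) i)"

definition r where
  "r j i = compact_avg h (\<lambda>m. sigma_avg \<sigma> (\<lambda>m s. u (real m * h) (real s * \<tau>)) j m
      - u (real m * h) ((real j + \<sigma>) * \<tau>)) i"

lemma t\<^sub>\<sigma>_in: assumes "j < M" shows "0 < (real j + \<sigma>) * \<tau>" "(real j + \<sigma>) * \<tau> \<le> T" "(real j + 1) * \<tau> \<le> T"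
proof -
  show "0 < (real j + \<sigma>) * \<tau>" using \<sigma>_bounds steps_pos by (simp add: add_nonneg_pos)
  show 1: "(real j + 1) * \<tau> \<le> T" using t_in[of "Suc j"] assms by (simp add: add.commute)
  have "(real j + \<sigma>) * \<tau> \<le> (real j + 1) * \<tau>" using \<sigma>_bounds steps_pos by (intro mult_right_mono) auto
  then show "(real j + \<sigma>) * \<tau> \<le> T" using 1 by simp
qed

lemma error_equation:
  assumes j: "j < M" and i: "i \<in> {1..n}"
  defines "t \<equiv> (real j + \<sigma>) * \<tau>"
  shows "discr_caputo \<alpha> \<sigma> lam \<tau> j (\<lambda>s. V s i)
     = k t * second_diff h (sigma_avg \<sigma> z j) i - q t * compact_avg h (sigma_avg \<sigma> z j) i + \<psi> j i + q t * r j i"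
proof -
  let ?U = "\<lambda>m s. u (real m * h) (real s * \<tau>)"
  have fe: "compact_avg h (\<lambda>m. f (real m * h) t) i
     = compact_avg h (\<lambda>m. gen_caputo \<alpha> lam T u (real m * h) t) i
       - k t * compact_avg h (\<lambda>m. partial_xt T 2 0 u (real m * h) t) i
       + q t * compact_avg h (\<lambda>m. u (real m * h) t) i"
  proof -
    \<comment> \<open>The factors 1 give the right-hand side the shape of two nested instances of
      \<open>compact_avg_linear\<close>.\<close>
    have "compact_avg h (\<lambda>m. f (real m * h) t) i = compact_avg h (\<lambda>m. 1 * (1 * gen_caputo \<alpha> lam T u (real m * h) t
        + (- k t) * partial_xt T 2 0 u (real m * h) t) + q t * u (real m * h) t) i"
    proof (rule compact_avg_cong)
      fix m assume "m \<le> Suc i"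
      then have "m \<le> Suc n" using i by simp
      then show "f (real m * h) t = 1 * (1 * gen_caputo \<alpha> lam T u (real m * h) t
        + (- k t) * partial_xt T 2 0 u (real m * h) t) + q t * u (real m * h) t"
        using equation_closed[OF t\<^sub>\<sigma>_in(1,2)[OF j] x_in] by (simp add: t_def)
    qed
    then show ?thesis unfolding compact_avg_linear by simp
  qed
  have sy: "compact_avg h (\<lambda>m. discr_caputo \<alpha> \<sigma> lam \<tau> j (y m)) i
     = k t * second_diff h (sigma_avg \<sigma> y j) i - q t * compact_avg h (sigma_avg \<sigma> y j) i
       + compact_avg h (\<lambda>m. f (real m * h) t) i"
    using y i j
    unfolding is_scheme_solution_def Let_def h_def[symmetric] \<tau>_def[symmetric] t_def compact_avg_discr_caputo by auto
  have sz: "sigma_avg \<sigma> z j = (\<lambda>m. sigma_avg \<sigma> ?U j m - sigma_avg \<sigma> y j m)"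
    by (simp add: sigma_avg_def z_def fun_eq_iff algebra_simps)
  have "discr_caputo \<alpha> \<sigma> lam \<tau> j (z m) = discr_caputo \<alpha> \<sigma> lam \<tau> j (?U m) - discr_caputo \<alpha> \<sigma> lam \<tau> j (y m)" for m
    unfolding discr_caputo_def right_diff_distrib[symmetric] sum_subtractf[symmetric] diff_divide_distrib[symmetric]
    by (intro arg_cong2[of _ _ _ _ "(*)"] arg_cong2[of _ _ _ _ "(/)"] refl sum.cong) (simp add: z_def)
  then have "discr_caputo \<alpha> \<sigma> lam \<tau> j (\<lambda>s. V s i)
     = compact_avg h (\<lambda>m. discr_caputo \<alpha> \<sigma> lam \<tau> j (?U m)) i - compact_avg h (\<lambda>m. discr_caputo \<alpha> \<sigma> lam \<tau> j (y m)) i"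
    by (simp add: V_def compact_avg_discr_caputo flip: compact_avg_diff)
  then show ?thesis
    unfolding sy fe \<psi>_def r_def sz compact_avg_diff second_diff_diff t_def[symmetric]
    by (simp add: algebra_simps)
qed

lemma r_bound:
  assumes j: "j < M" and i: "i \<in> {1..n}"
  shows "\<bar>r j i\<bar> \<le> C * \<tau>\<^sup>2"
proof -
  have "\<bar>sigma_avg \<sigma> (\<lambda>m s. u (real m * h) (real s * \<tau>)) j m - u (real m * h) ((real j + \<sigma>) * \<tau>)\<bar> \<le> C * \<tau>\<^sup>2"
    if "m \<le> Suc i" for m
  proof -
    have m: "m \<le> Suc n" using that i by simp
    have "\<bar>u (real m * h) (real j * \<tau> + \<sigma> * \<tau>) - (\<sigma> * u (real m * h) (real j * \<tau> + \<tau>) + (1 - \<sigma>) * u (real m * h) (real j * \<tau>))\<bar> \<le> C * \<tau>\<^sup>2"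
    proof (rule sigma_avg_error[of "{0..T}" _ "partial_xt T 0 1 u (real m * h)" "partial_xt T 0 2 u (real m * h)"])
      fix s assume s: "s \<in> {0..T}"
      show "(u (real m * h) has_real_derivative partial_xt T 0 1 u (real m * h) s) (at s within {0..T})"
        using C_xt_class_deriv_t[OF u _ x_in[OF m] s, of 0] by (simp add: partial_xt_0_0[abs_def])
      show "(partial_xt T 0 1 u (real m * h) has_real_derivative partial_xt T 0 2 u (real m * h) s) (at s within {0..T})"
        using C_xt_class_deriv_t[OF u _ x_in[OF m] s, of 1] by (simp add: numeral_2_eq_2)
      show "\<bar>partial_xt T 0 2 u (real m * h) s\<bar> \<le> C"
        using s x_in[OF m] by (intro C_bounds) auto
    qed (use t\<^sub>\<sigma>_in[OF j] t_in[of j] j \<sigma>_bounds steps_pos in \<open>auto simp: algebra_simps\<close>)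
    then show ?thesis by (simp add: sigma_avg_def abs_minus_commute algebra_simps)
  qed
  then show ?thesis unfolding r_def using steps_pos by (intro compact_avg_abs_le)
qed

lemma \<psi>_bound:
  assumes j: "j < M" and i: "i \<in> {1..n}"
  shows "\<bar>\<psi> j i\<bar> \<le> K\<^sub>t * \<tau>\<^sup>2 + c2 * (C * h ^ 4 + 2 * C * \<tau>\<^sup>2)"
proof -
  define t where "t = (real j + \<sigma>) * \<tau>"
  define x where "x = real i * h"
  have t: "t \<in> {0..T}" using t\<^sub>\<sigma>_in[OF j] by (simp add: t_def)
  have x: "real (Suc i) * h = x + h" "real (i - 1) * h = x - h"
    using i by (simp_all add: x_def of_nat_diff algebra_simps)
  have xin: "x \<in> {0..1}" "x + h \<in> {0..1}" "x - h \<in> {0..1}"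
    using x_in[of i] x_in[of "Suc i"] x_in[of "i - 1"] i unfolding x by (auto simp: x_def)
  have "\<bar>compact_avg h (\<lambda>m. discr_caputo \<alpha> \<sigma> lam \<tau> j (\<lambda>s. u (real m * h) (real s * \<tau>))
              - gen_caputo \<alpha> lam T u (real m * h) ((real j + \<sigma>) * \<tau>)) i\<bar> \<le> K\<^sub>t * \<tau>\<^sup>2"
  proof (rule compact_avg_abs_le[OF steps_pos(1)])
    fix m assume "m \<le> Suc i"
    then have "m \<le> Suc n" using i by simp
    from time_truncation[OF x_in[OF this] steps_pos(2) t\<^sub>\<sigma>_in(3)[OF j]]
    show "\<bar>discr_caputo \<alpha> \<sigma> lam \<tau> j (\<lambda>s. u (real m * h) (real s * \<tau>))
              - gen_caputo \<alpha> lam T u (real m * h) ((real j + \<sigma>) * \<tau>)\<bar> \<le> K\<^sub>t * \<tau>\<^sup>2"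
      by (subst abs_minus_commute)
  qed
  moreover have "\<bar>k t * (compact_avg h (\<lambda>m. partial_xt T 2 0 u (real m * h) t) i
         - second_diff h (sigma_avg \<sigma> (\<lambda>m s. u (real m * h) (real s * \<tau>)) j) i)\<bar> \<le> c2 * (C * h ^ 4 + 2 * C * \<tau>\<^sup>2)"
  proof -
    have "\<bar>(partial_xt T 2 0 u x t + (partial_xt T 2 0 u (x + h) t - 2 * partial_xt T 2 0 u x t + partial_xt T 2 0 u (x - h) t) / 12)
       - (partial_xt T 0 0 u (x + h) t - 2 * partial_xt T 0 0 u x t + partial_xt T 0 0 u (x - h) t) / h\<^sup>2\<bar> \<le> C * h ^ 4"
      using xin t steps_pos C_xt_class_deriv_x[OF u] C_bounds(2)
      by (intro compact_second_diff_error[of "{0..1}" "\<lambda>r x. partial_xt T r 0 u x t"]) auto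
    then have 1: "\<bar>compact_avg h (\<lambda>m. partial_xt T 2 0 u (real m * h) t) i - second_diff h (\<lambda>m. u (real m * h) t) i\<bar> \<le> C * h ^ 4"
      by (simp add: compact_avg_eq[OF steps_pos(1)] second_diff_def partial_xt_0_0 flip: x x_def)
    \<comment> \<open>The time derivatives of the second difference quotient of \<open>u\<close>.
      \<open>G 2\<close> is a second difference of the second time derivative, so two further space
      derivatives compensate the division by \<open>h^2\<close>, and the weighting in time costs no
      negative power of \<open>h\<close>.\<close>
    define G where "G s t = (partial_xt T 0 s u (x + h) t - 2 * partial_xt T 0 s u x t + partial_xt T 0 s u (x - h) t) / h\<^sup>2" for s t
    have "\<bar>G 0 (real j * \<tau> + \<sigma> * \<tau>) - (\<sigma> * G 0 (real j * \<tau> + \<tau>) + (1 - \<sigma>) * G 0 (real j * \<tau>))\<bar> \<le> (2 * C) * \<tau>\<^sup>2"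
    proof (rule sigma_avg_error[of "{0..T}" _ "G 1" "G 2"])
      fix s assume s: "s \<in> {0..T}"
      have 2: "Suc 1 = 2" by simp
      show "(G 0 has_real_derivative G 1 s) (at s within {0..T})" "(G 1 has_real_derivative G 2 s) (at s within {0..T})"
        unfolding G_def using xin s C_xt_class_deriv_t[OF u _ _ s, of 0] C_xt_class_deriv_t[OF u _ _ s, of 1]
        by (auto intro!: DERIV_cdivide DERIV_add DERIV_diff DERIV_cmult simp only: 2 One_nat_def[symmetric])
      have "\<bar>partial_xt T 0 2 u (x + h) s - 2 * partial_xt T 0 2 u x s + partial_xt T 0 2 u (x - h) s\<bar> \<le> 2 * C * h\<^sup>2"
      proof (rule second_diff_le[of "{0..1}" _ "\<lambda>x. partial_xt T (Suc 0) 2 u x s" "\<lambda>x. partial_xt T (Suc (Suc 0)) 2 u x s"])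
        fix x :: real assume x: "x \<in> {0..1}"
        show "((\<lambda>x. partial_xt T 0 2 u x s) has_real_derivative partial_xt T (Suc 0) 2 u x s) (at x within {0..1})"
             "((\<lambda>x. partial_xt T (Suc 0) 2 u x s) has_real_derivative partial_xt T (Suc (Suc 0)) 2 u x s) (at x within {0..1})"
          using C_xt_class_deriv_x[OF u _ _ x s, of 0 2] C_xt_class_deriv_x[OF u _ _ x s, of 1 2] by simp_all
        show "\<bar>partial_xt T (Suc (Suc 0)) 2 u x s\<bar> \<le> C" using x s by (intro C_bounds) auto
      qed (use xin in auto)
      then show "\<bar>G 2 s\<bar> \<le> 2 * C"
        using steps_pos by (simp add: G_def abs_divide divide_le_eq)
    qed (use t\<^sub>\<sigma>_in[OF j] t_in[of j] j \<sigma>_bounds steps_pos in \<open>auto simp: algebra_simps\<close>)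
    moreover have "G 0 (real j * \<tau> + \<sigma> * \<tau>) = second_diff h (\<lambda>m. u (real m * h) t) i"
      by (simp add: G_def second_diff_def partial_xt_0_0 t_def distrib_right flip: x x_def)
    moreover have "\<sigma> * G 0 (real j * \<tau> + \<tau>) + (1 - \<sigma>) * G 0 (real j * \<tau>)
       = second_diff h (sigma_avg \<sigma> (\<lambda>m s. u (real m * h) (real s * \<tau>)) j) i"
    proof -
      have "real j * \<tau> + \<tau> = real (j + 1) * \<tau>" by (simp add: algebra_simps)
      then show ?thesis
        by (simp only: G_def second_diff_def sigma_avg_def partial_xt_0_0 x_def[symmetric] x[symmetric] Suc_eq_plus1)
           (simp add: diff_divide_distrib add_divide_distrib algebra_simps)
    qed
    ultimately have 2: "\<bar>second_diff h (\<lambda>m. u (real m * h) t) i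
        - second_diff h (sigma_avg \<sigma> (\<lambda>m s. u (real m * h) (real s * \<tau>)) j) i\<bar> \<le> 2 * C * \<tau>\<^sup>2" by simp
    have "\<bar>compact_avg h (\<lambda>m. partial_xt T 2 0 u (real m * h) t) i
         - second_diff h (sigma_avg \<sigma> (\<lambda>m s. u (real m * h) (real s * \<tau>)) j) i\<bar> \<le> C * h ^ 4 + 2 * C * \<tau>\<^sup>2"
      using 1 2 by linarith
    moreover have "\<bar>k t\<bar> \<le> c2" using kq t c1 by fastforce
    ultimately show ?thesis unfolding abs_mult by (intro mult_mono') auto
  qed
  ultimately show ?thesis unfolding \<psi>_def t_def by linarith
qed

text \<open>The sum of the bound on \<open>r\<close> and of the bound on \<open>\<psi>\<close>
  divided by \<open>2/3 * c1\<close>; it thus meets both smallness conditions of the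
  dichotomy.\<close>

definition R where "R = C * \<tau>\<^sup>2 + 3 / (2 * c1) * (K\<^sub>t * \<tau>\<^sup>2 + c2 * (C * h ^ 4 + 2 * C * \<tau>\<^sup>2))"

lemma c2_pos: "0 < c2" using kq c1 T by force

lemma R_bounds: "0 \<le> R" "C * \<tau>\<^sup>2 \<le> R" "K\<^sub>t * \<tau>\<^sup>2 + c2 * (C * h ^ 4 + 2 * C * \<tau>\<^sup>2) \<le> 2/3 * c1 * R"
proof -
  have a: "0 \<le> C * \<tau>\<^sup>2" and b: "0 \<le> K\<^sub>t * \<tau>\<^sup>2 + c2 * (C * h ^ 4 + 2 * C * \<tau>\<^sup>2)"
    using C_nonneg K\<^sub>t_nonneg c2_pos by auto
  then have "0 \<le> 3 / (2 * c1) * (K\<^sub>t * \<tau>\<^sup>2 + c2 * (C * h ^ 4 + 2 * C * \<tau>\<^sup>2))"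
    using c1 by (intro mult_nonneg_nonneg) auto
  with a show "0 \<le> R" "C * \<tau>\<^sup>2 \<le> R" unfolding R_def by linarith+
  have "2/3 * c1 * R = 2/3 * c1 * (C * \<tau>\<^sup>2) + (K\<^sub>t * \<tau>\<^sup>2 + c2 * (C * h ^ 4 + 2 * C * \<tau>\<^sup>2))"
    unfolding R_def distrib_left using c1 by simp
  moreover have "0 \<le> 2/3 * c1 * (C * \<tau>\<^sup>2)" using c1 by (intro mult_nonneg_nonneg[OF _ a]) auto
  ultimately show "K\<^sub>t * \<tau>\<^sup>2 + c2 * (C * h ^ 4 + 2 * C * \<tau>\<^sup>2) \<le> 2/3 * c1 * R" by linarith
qed

text \<open>The divisor \<open>1 - \<alpha>\<close> is \<open>2 * \<sigma> - 1\<close>: the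
  dichotomy threshold \<open>sqrt n * R\<close> has to equal \<open>(2 * \<sigma> - 1) * E\<close>.
  All earlier levels enter the induction because the discrete derivative has full memory.\<close>

lemma level_bound:
  assumes "j \<le> M"
  shows "\<forall>s\<le>j. L2_set (V s) {1..n} \<le> sqrt n * R / (1 - \<alpha>)"
  using assms
proof (induction j)
  case 0
  have "L2_set (V 0) {1..n} = 0" using V_0 by (intro L2_set_0') auto
  then show ?case using R_bounds \<alpha> by simp
next
  case (Suc j)
  then have j: "j < M" by simp
  define t where "t = (real j + \<sigma>) * \<tau>"
  define Z where "Z = sigma_avg \<sigma> z j"
  define W where "W i = \<sigma> * V (Suc j) i + (1 - \<sigma>) * V j i" for i
  \<comment> \<open>Index reversal makes the weights increase in s, with the coefficient of index 0
    at the newest level.\<close>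
  define g where "g s = c_coef \<alpha> \<sigma> lam \<tau> j (j - s)" for s
  define \<kappa> where "\<kappa> = \<tau> powr (1 - \<alpha>) / Gamma (2 - \<alpha>) / \<tau>"
  define D where "D i = (\<Sum>s\<le>j. g s * (V (Suc s) i - V s i))" for i
  have \<kappa>: "0 < \<kappa>" using steps_pos \<alpha> by (simp add: \<kappa>_def Gamma_real_pos)
  have D: "discr_caputo \<alpha> \<sigma> lam \<tau> j (\<lambda>s. V s i) = \<kappa> * D i" for i
    by (simp add: discr_caputo_def \<kappa>_def D_def g_def atMost_atLeast0 flip: sum_divide_distrib)
  have t: "t \<in> {0..T}" using t\<^sub>\<sigma>_in[OF j] by (simp add: t_def)
  have WZ: "W i = compact_avg h Z i" for i
    by (simp add: W_def V_def Z_def sigma_avg_compact_avg)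
  have dich: "L2_set W {1..n} \<le> sqrt n * R \<or> (\<Sum>i=1..n. W i * (\<kappa> * D i)) \<le> 0"
  proof (rule error_equation_dichotomy[where Z = Z and \<kappa> = "k t" and d = "q t" and \<psi> = "\<psi> j" and r = "r j" and c = c1])
    show "Z 0 = 0" "Z (Suc n) = 0" using j by (simp_all add: Z_def sigma_avg_def z_0)
    show "W i = Z i + diff2 Z i / 12" for i by (simp add: WZ compact_avg_eq steps_pos)
    show "0 < c1" "c1 \<le> k t" "0 \<le> q t" using c1 kq t by auto
    fix i assume i: "i \<in> {1..n}"
    have "second_diff h Z i = (real (Suc n))\<^sup>2 * diff2 Z i"
      by (simp add: second_diff_def h_def power_divide)
    then show "\<kappa> * D i = k t * ((real (Suc n))\<^sup>2 * diff2 Z i) - q t * W i + \<psi> j i + q t * r j i"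
      using error_equation[OF j i] by (simp add: D WZ t_def Z_def)
    show "\<bar>\<psi> j i\<bar> \<le> 2/3 * c1 * R" "\<bar>r j i\<bar> \<le> R"
      using \<psi>_bound[OF j i] r_bound[OF j i] R_bounds by linarith+
  qed (rule R_bounds)
  have "(\<Sum>i=1..n. W i * (\<kappa> * D i)) = \<kappa> * (\<Sum>i=1..n. W i * D i)"
    by (simp add: sum_distrib_left mult_ac)
  with dich \<kappa> have dich: "L2_set W {1..n} \<le> (2 * \<sigma> - 1) * (sqrt n * R / (1 - \<alpha>)) \<or> (\<Sum>i=1..n. W i * D i) \<le> 0"
    using \<alpha> by (simp add: \<sigma>_bounds mult_le_0_iff)
  note tT = t\<^sub>\<sigma>_in(2)[OF j]
  have "L2_set (V (Suc j)) {1..n} \<le> sqrt n * R / (1 - \<alpha>)"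
  proof (rule level_bound_step[where g = g])
    show "0 \<le> g 0" "0 < g j"
      using c_coef_nonneg[OF steps_pos(2) tT] c_coef_0_pos[OF steps_pos(2) tT] by (simp_all add: g_def)
    show "g s \<le> g (Suc s)" if "s < j" for s
      using c_coef_antimono[OF steps_pos(2) tT, of "j - Suc s"] that by (simp add: g_def Suc_diff_Suc)
    show "\<sigma> * g i \<le> (2 * \<sigma> - 1) * g j" if "j = Suc i" for i
      using c_coef_1_le[OF steps_pos(2) tT] that by (simp add: g_def \<sigma>_bounds)
    show "L2_set (\<lambda>i. \<sigma> * V (Suc j) i + (1 - \<sigma>) * V j i) {1..n} \<le> (2 * \<sigma> - 1) * (sqrt n * R / (1 - \<alpha>))
        \<or> (\<Sum>i=1..n. (\<sigma> * V (Suc j) i + (1 - \<sigma>) * V j i) * (\<Sum>s\<le>j. g s * (V (Suc s) i - V s i))) \<le> 0"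
      using dich unfolding W_def[abs_def] D_def .
  qed (use \<sigma>_bounds Suc in auto)
  with Suc show ?case by (auto simp: le_Suc_eq)
qed

text \<open>The factor 3/2 is the root of the 9/4 lost in passing from the averaged error to the
  error itself; \<open>sqrt n\<close> is absorbed by the mesh weight in
  \<open>l2_norm\<close>.\<close>

lemma error_bound:
  assumes "j \<le> M"
  shows "l2_norm (Suc n) (\<lambda>m. z m j) \<le> 3/2 * (R / (1 - \<alpha>))"
proof -
  define X where "X = R / (1 - \<alpha>)"
  have X: "0 \<le> X" using R_bounds \<alpha> by (simp add: X_def)
  have "(\<Sum>i=1..n. (z i j)\<^sup>2) \<le> 9/4 * (\<Sum>i=1..n. (V j i)\<^sup>2)"
    using compact_sq_ge[of "\<lambda>m. z m j" n] z_0[OF assms] steps_pos by (simp add: V_def compact_avg_eq)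
  also have "(\<Sum>i=1..n. (V j i)\<^sup>2) = (L2_set (V j) {1..n})\<^sup>2"
    by (simp add: L2_set_def sum_nonneg)
  also have "\<dots> \<le> (sqrt n * X)\<^sup>2"
    using level_bound[OF assms] by (intro power_mono) (auto simp: X_def)
  also have "\<dots> = real n * X\<^sup>2" by (simp add: power_mult_distrib)
  also have "\<dots> \<le> real (Suc n) * X\<^sup>2" by (intro mult_right_mono) auto
  finally have "(\<Sum>i=1..n. (z i j)\<^sup>2) * (1 / real (Suc n)) \<le> (3/2 * X)\<^sup>2"
    by (simp add: divide_le_eq power_mult_distrib power_divide mult_ac)
  then have "sqrt ((\<Sum>i=1..n. (z i j)\<^sup>2) * (1 / real (Suc n))) \<le> \<bar>3/2 * X\<bar>"
    using real_sqrt_le_mono by fastforce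
  then show ?thesis using X by (simp add: l2_norm_def flip: sum_distrib_right sum_divide_distrib X_def)
qed

lemma R_le: "R \<le> (C + 3 / (2 * c1) * (K\<^sub>t + 2 * (c2 * C))) * (\<tau>\<^sup>2 + h ^ 4)"
proof -
  have "K\<^sub>t * \<tau>\<^sup>2 + c2 * (C * h ^ 4 + 2 * C * \<tau>\<^sup>2) \<le> (K\<^sub>t + 2 * (c2 * C)) * (\<tau>\<^sup>2 + h ^ 4)"
    using K\<^sub>t_nonneg C_nonneg c2_pos by (simp add: algebra_simps)
  then have "3 / (2 * c1) * (K\<^sub>t * \<tau>\<^sup>2 + c2 * (C * h ^ 4 + 2 * C * \<tau>\<^sup>2)) \<le> 3 / (2 * c1) * ((K\<^sub>t + 2 * (c2 * C)) * (\<tau>\<^sup>2 + h ^ 4))"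
    using c1 by (intro mult_left_mono) auto
  moreover have "C * \<tau>\<^sup>2 \<le> C * (\<tau>\<^sup>2 + h ^ 4)" using C_nonneg by (intro mult_left_mono) auto
  ultimately have "R \<le> C * (\<tau>\<^sup>2 + h ^ 4) + 3 / (2 * c1) * ((K\<^sub>t + 2 * (c2 * C)) * (\<tau>\<^sup>2 + h ^ 4))"
    unfolding R_def by (rule add_mono[rotated])
  then show ?thesis by (simp only: distrib_right[of C] mult.assoc)
qed

end

lemma convergence:
  "\<exists>C\<^sub>R > 0. \<forall>N M :: nat. \<forall>y.
     N \<ge> 1 \<longrightarrow> M \<ge> 1 \<longrightarrow>
     is_scheme_solution \<alpha> \<sigma> lam T k q f u0 N M y \<longrightarrow>
     (\<forall>j\<in>{1..M}.
        l2_norm N (\<lambda>i. u (real i / real N) (real j * (T / real M)) - y i j)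
        \<le> C\<^sub>R * ((T / real M)\<^sup>2 + (1 / real N) ^ 4))"
proof (intro exI conjI allI impI ballI)
  define K where "K = 3/2 * ((C + 3 / (2 * c1) * (K\<^sub>t + 2 * (c2 * C))) / (1 - \<alpha>))"
  have c2: "0 < c2" using kq c1 T by force
  have "0 \<le> C + 3 / (2 * c1) * (K\<^sub>t + 2 * (c2 * C))"
    using c1 c2 C_nonneg K\<^sub>t_nonneg by (intro add_nonneg_nonneg mult_nonneg_nonneg) auto
  then have "0 \<le> K" unfolding K_def using \<alpha> by (intro mult_nonneg_nonneg[OF _ divide_nonneg_nonneg]) auto
  \<comment> \<open>\<open>K\<close> vanishes when \<open>C = 0\<close>, so 1 is added to obtain a
    positive constant.\<close>
  then show "0 < K + 1" by simp
  fix N M :: nat and y j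
  assume N: "1 \<le> N" and M: "1 \<le> M" and y: "is_scheme_solution \<alpha> \<sigma> lam T k q f u0 N M y" and j: "j \<in> {1..M}"
  obtain n where n: "N = Suc n" using N by (cases N) auto
  note ctx = M refl refl y[unfolded n]
  have "l2_norm N (\<lambda>i. u (real i / real N) (real j * (T / real M)) - y i j) \<le> 3/2 * (R (1 / real N) (T / real M) / (1 - \<alpha>))"
    using error_bound[OF ctx, of j, unfolded z_def[OF ctx]] j by (simp add: n)
  also have "\<dots> \<le> K * ((T / real M)\<^sup>2 + (1 / real N) ^ 4)"
  proof -
    let ?X = "(T / real M)\<^sup>2 + (1 / real N) ^ 4"
    have "R (1 / real N) (T / real M) / (1 - \<alpha>) \<le> (C + 3 / (2 * c1) * (K\<^sub>t + 2 * (c2 * C))) * ?X / (1 - \<alpha>)"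
      using R_le[OF ctx] \<alpha> unfolding n by (intro divide_right_mono) auto
    then have "3/2 * (R (1 / real N) (T / real M) / (1 - \<alpha>)) \<le> 3/2 * ((C + 3 / (2 * c1) * (K\<^sub>t + 2 * (c2 * C))) * ?X / (1 - \<alpha>))"
      by (rule mult_left_mono) simp
    also have "\<dots> = K * ?X" unfolding K_def by (simp only: times_divide_eq_left times_divide_eq_right mult.assoc)
    finally show ?thesis .
  qed
  also have "\<dots> \<le> (K + 1) * ((T / real M)\<^sup>2 + (1 / real N) ^ 4)"
    by (intro mult_right_mono) auto
  finally show "l2_norm N (\<lambda>i. u (real i / real N) (real j * (T / real M)) - y i j)
      \<le> (K + 1) * ((T / real M)\<^sup>2 + (1 / real N) ^ 4)" .
qed

end

theorem theorem5p2:
  fixes \<alpha> \<sigma> T c1 c2 :: real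
    and lam k q u0 :: "real \<Rightarrow> real"
    and f u :: "real \<Rightarrow> real \<Rightarrow> real"
  assumes "0 < \<alpha>" and "\<alpha> < 1"
    and "\<sigma> = 1 - \<alpha> / 2"
    and "T > 0"
    and "C_class 2 {0..T} lam"
    and "\<forall>t\<in>{0..T}. lam t > 0 \<and> deriv_on {0..T} lam t \<le> 0"
    and "0 < c1"
    and "\<forall>t\<in>{0..T}. c1 \<le> k t \<and> k t \<le> c2 \<and> q t \<ge> 0"
    and "continuous_on ({0..1} \<times> {0..T}) (\<lambda>(x, t). f x t)"
    and "C_xt_class T 6 3 u"
    and "is_exact_solution \<alpha> lam T k q f u0 u"
  shows "\<exists>C\<^sub>R > 0. \<forall>N M :: nat. \<forall>y.
           N \<ge> 1 \<longrightarrow> M \<ge> 1 \<longrightarrow>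
           is_scheme_solution \<alpha> \<sigma> lam T k q f u0 N M y \<longrightarrow>
           (\<forall>j\<in>{1..M}.
              l2_norm N (\<lambda>i. u (real i / real N) (real j * (T / real M)) - y i j)
              \<le> C\<^sub>R * ((T / real M)\<^sup>2 + (1 / real N) ^ 4))"
proof -
  interpret diffusion_problem \<alpha> \<sigma> T c1 c2 lam k q u0 f u
    by unfold_locales (fact assms)+
  show ?thesis by (rule convergence)
qed

end
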